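(* Let $K\ge0$ be an integer and $\gamma_0=1,\gamma_1,\dots,\gamma_K$ real numbers. Let $e_n(x)=\sum_{j=0}^nj!\,S(n,j)x^j$ for $n\ge0$ (with $S(n,j)$ the Stirling numbers of the second kind), $e_i=0$ for $i<0$, and $p_n(x)=\sum_{j=0}^K\gamma_je_{n-j}(x)$. Let $P(x)=\sum_{j=0}^K\gamma_jx^{K-j}$ and assume $P(m)\ne0$ for every positive integer $m$. Let $\mathcal{H}=\{l\in\mathbb{Z}_{>0}:P(l)P(l+1)<0\}=\{h_1<\dots<h_{s_{\mathcal H}}\}$ and $\mathcal{G}=\mathbb{Z}_{>0}\setminus\mathcal{H}=\{g_1<g_2<\cdots\}$. Then there exists $n_0$ such that for $n\ge n_0$ the polynomial $p_n$ has exactly $s_{\mathcal H}$ positive zeros, all simple. Writing $\xi_m^+(n)$, $1\le m\le s_{\mathcal H}$, for the positive zeros of $p_n$ in increasing order and $\xi_m^-(n)$ for the negative zeros of $p_n$ in decreasing order (counted with multiplicity), we have $$\lim_{n\to\infty}\frac{\xi_m^+(n)}{-\frac{P(h_m)}{P(h_m+1)}\left(\frac{h_m}{h_m+1}\right)^{n-K}}=1,\quad1\le m\le s_{\mathcal H},$$ $$\lim_{n\to\infty}\frac{\xi_m^-(n)}{-\frac{P(g_m)}{P(g_m+1)}\left(\frac{g_m}{g_m+1}\right)^{n-K}}=1,\quad m\ge1.$$ Moreover, for any positive integer $m$, $n_0$ can be chosen so that for $n\ge n_0$ the $m$ rightmost negative zeros of $p_n$ are simple.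
   Context: $e_n(x)=x^n\mathcal{E}_n(1+1/x)$ where $\mathcal{E}_n$ is the $n$-th Eulerian polynomial; $S(n,j)=\sum_{i=0}^j\frac{(-1)^{j-i}i^n}{(j-i)!\,i!}$. *)

theory Defs
  imports
    "HOL-Analysis.Analysis"
    "HOL-Computational_Algebra.Polynomial"
    "HOL-Combinatorics.Stirling"
    "HOL-Library.Infinite_Set"
begin

text \<open>
  The index is an integer because \<open>e\<^sub>i = 0\<close> for \<open>i < 0\<close> is used in the definition of \<open>p\<^sub>n\<close>.
\<close>

definition e_poly :: "int \<Rightarrow> real poly" where
  "e_poly i = (if i < 0 then 0
     else (\<Sum>j\<le>nat i. monom (fact j * real (Stirling (nat i) j)) j))"

definition p_poly :: "(nat \<Rightarrow> real) \<Rightarrow> nat \<Rightarrow> nat \<Rightarrow> real poly" where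
  "p_poly \<gamma> K n = (\<Sum>j\<le>K. smult (\<gamma> j) (e_poly (int n - int j)))"

definition P_poly :: "(nat \<Rightarrow> real) \<Rightarrow> nat \<Rightarrow> real poly" where
  "P_poly \<gamma> K = (\<Sum>j\<le>K. monom (\<gamma> j) (K - j))"

definition H_set :: "real poly \<Rightarrow> nat set" where
  "H_set P = {l. 0 < l \<and> poly P (real l) * poly P (real (l + 1)) < 0}"

definition G_set :: "real poly \<Rightarrow> nat set" where
  "G_set P = {l. 0 < l} - H_set P"

text \<open>
  For \<open>A = {a\<^sub>1 < a\<^sub>2 < \<dots>}\<close>, finite or infinite, \<open>nth_elem A m\<close> is \<open>a\<^sub>m\<close>, with indices starting
  at 1; for finite \<open>A\<close> it is meaningful only for \<open>1 \<le> m \<le> card A\<close>.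
\<close>

definition nth_elem :: "nat set \<Rightarrow> nat \<Rightarrow> nat" where
  "nth_elem A m = enumerate A (m - 1)"

definition pos_zeros :: "real poly \<Rightarrow> real list" where
  "pos_zeros p = sorted_list_of_multiset (filter_mset (\<lambda>x. 0 < x) (proots p))"

definition neg_zeros :: "real poly \<Rightarrow> real list" where
  "neg_zeros p = rev (sorted_list_of_multiset (filter_mset (\<lambda>x. x < 0) (proots p)))"

text \<open>
  The \<open>m\<close>-th positive zero in increasing order and the \<open>m\<close>-th negative zero in decreasing order,
  counted with multiplicity and with indices starting at 1; they are meaningful only for
  \<open>1 \<le> m \<le> length (pos_zeros p)\<close> and \<open>1 \<le> m \<le> length (neg_zeros p)\<close>, respectively.
\<close>

definition xi_pos :: "real poly \<Rightarrow> nat \<Rightarrow> real" where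
  "xi_pos p m = pos_zeros p ! (m - 1)"

definition xi_neg :: "real poly \<Rightarrow> nat \<Rightarrow> real" where
  "xi_neg p m = neg_zeros p ! (m - 1)"

end

theory Submission
  imports Defs
begin

text \<open>
  With \<open>y = x / (1 + x)\<close> one has \<open>(1 + x) p\<^sub>n(x) = \<Sum>k. P(k) k\<^sup>N y\<^sup>k\<close> for \<open>x > -1/2\<close>,
  where \<open>N = n - K\<close>. For \<open>y = u (l/(l+1))\<^sup>N\<close> the terms \<open>k = l\<close> and \<open>k = l + 1\<close> dominate all the
  others, so by Tannery's theorem the rescaled series tends to \<open>P(l) u\<^sup>l + P(l+1) u\<^sup>l\<^sup>+\<^sup>1\<close>, and
  the intermediate value theorem gives a zero near \<open>u = -P(l)/P(l+1)\<close>. Positive and negative zeros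
  are treated alike, by passing to the coefficients \<open>c\<^sub>k = P(k) \<sigma>\<^sup>k\<close> with \<open>\<sigma> = 1\<close> or \<open>\<sigma> = -1\<close>,
  and \<open>H\<close>, \<open>G\<close> are the sets of sign changes of these.

  That there are no further zeros, and that the zeros are simple, follows as in Descartes' rule of
  signs: by Rolle, the operator \<open>z d/dz - (l + 1/2)\<close> loses at most one zero, and applying it for each
  \<open>l\<close> in a finite set \<open>T\<close> of sign changes multiplies \<open>c\<^sub>k\<close> by \<open>\<Prod>l\<in>T. k - l - 1/2\<close>, which
  removes these sign changes. If \<open>T\<close> contains all of them, the resulting series has no zero in
  \<open>(0, 1)\<close>; if \<open>T\<close> consists of those up to \<open>g\<close>, it has none in the range of the zeros belonging to \<open>T\<close>.
\<close>

subsection \<open>Power series on the unit disc and Descartes' rule\<close>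

definition disc_summable :: "(nat \<Rightarrow> real) \<Rightarrow> bool" where
  "disc_summable c \<longleftrightarrow> (\<forall>z. \<bar>z\<bar> < 1 \<longrightarrow> summable (\<lambda>k. c k * z ^ k))"

definition pser :: "(nat \<Rightarrow> real) \<Rightarrow> real \<Rightarrow> real" where
  "pser c z = (\<Sum>k. c k * z ^ k)"

lemma disc_summableD: "disc_summable c \<Longrightarrow> \<bar>z\<bar> < 1 \<Longrightarrow> summable (\<lambda>k. c k * z ^ k)"
  by (simp add: disc_summable_def)

lemma disc_summable_diffs: "disc_summable c \<Longrightarrow> disc_summable (diffs c)"
  unfolding disc_summable_def by (metis termdiff_converges real_norm_def)

lemma disc_summable_index_sums:
  assumes "disc_summable c" "\<bar>z\<bar> < 1"
  shows "(\<lambda>k. real k * c k * z ^ k) sums (z * pser (diffs c) z)"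
proof -
  have "(\<lambda>k. diffs c k * z ^ k) sums pser (diffs c) z"
    unfolding pser_def using disc_summableD[OF disc_summable_diffs[OF assms(1)] assms(2)]
    by (rule summable_sums)
  hence "(\<lambda>k. z * (diffs c k * z ^ k)) sums (z * pser (diffs c) z)"
    by (rule sums_mult)
  also have "(\<lambda>k. z * (diffs c k * z ^ k)) = (\<lambda>k. real (Suc k) * c (Suc k) * z ^ Suc k)"
    by (simp add: diffs_def algebra_simps)
  finally show ?thesis
    by (subst (asm) sums_Suc_iff) simp
qed

lemma disc_summable_index: "disc_summable c \<Longrightarrow> disc_summable (\<lambda>k. real k * c k)"
  using disc_summable_index_sums sums_summable unfolding disc_summable_def by blast

lemma disc_summable_add:
  "disc_summable c \<Longrightarrow> disc_summable d \<Longrightarrow> disc_summable (\<lambda>k. c k + d k)"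
  unfolding disc_summable_def by (auto simp: distrib_right intro: summable_add)

lemma disc_summable_cmult: "disc_summable c \<Longrightarrow> disc_summable (\<lambda>k. a * c k)"
  unfolding disc_summable_def by (auto simp: mult.assoc intro: summable_mult)

lemma disc_summable_shift:
  assumes "disc_summable c"
  shows "disc_summable (\<lambda>k. (real k - a) * c k)"
proof -
  have "(\<lambda>k. (real k - a) * c k) = (\<lambda>k. real k * c k + (- a) * c k)"
    by (simp add: algebra_simps)
  thus ?thesis
    using disc_summable_add[OF disc_summable_index disc_summable_cmult, OF assms assms] by metis
qed

lemma disc_summable_prod_shift:
  "finite C \<Longrightarrow> disc_summable c \<Longrightarrow> disc_summable (\<lambda>k. (\<Prod>a\<in>C. real k - a) * c k)"
proof (induction arbitrary: c rule: finite_induct)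
  case (insert a C)
  have "disc_summable (\<lambda>k. (real k - a) * ((\<Prod>a\<in>C. real k - a) * c k))"
    by (intro disc_summable_shift insert)
  thus ?case using insert.hyps by (simp add: mult.assoc)
qed simp

lemma disc_summable_power_index:
  "disc_summable c \<Longrightarrow> disc_summable (\<lambda>k. c k * real k ^ n)"
proof (induction n)
  case (Suc n)
  have "disc_summable (\<lambda>k. real k * (c k * real k ^ n))"
    by (intro disc_summable_index Suc)
  thus ?case by (simp add: mult.left_commute)
qed simp

lemma disc_summable_abs:
  assumes "disc_summable c" "\<bar>z\<bar> < 1"
  shows "summable (\<lambda>k. \<bar>c k\<bar> * \<bar>z\<bar> ^ k)"
proof -
  \<comment> \<open>Convergence at the larger radius \<open>r\<close> makes the series at
    \<open>z\<close> absolutely convergent.\<close>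
  obtain r where r: "\<bar>z\<bar> < r" "r < 1" using assms(2) dense by blast
  have "summable (\<lambda>k. norm (c k * z ^ k))"
    by (rule powser_insidea[of _ r]) (use r in \<open>auto intro!: disc_summableD assms\<close>)
  thus ?thesis by (simp add: abs_mult power_abs)
qed

lemma disc_summable_abs_le:
  assumes "disc_summable c" "\<And>k. \<bar>d k\<bar> \<le> \<bar>c k\<bar>"
  shows "disc_summable d"
  unfolding disc_summable_def
proof (intro allI impI)
  fix z :: real assume z: "\<bar>z\<bar> < 1"
  show "summable (\<lambda>k. d k * z ^ k)"
    by (rule summable_comparison_test'[OF disc_summable_abs[OF assms(1) z], of 0])
       (auto simp: abs_mult power_abs intro: mult_right_mono assms(2))
qed

lemma disc_summable_poly: "disc_summable (\<lambda>k. poly p (real k))"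
proof (induction p rule: pCons_induct)
  case 0
  show ?case by (simp add: disc_summable_def)
next
  case (pCons a p)
  have "disc_summable (\<lambda>_. a)"
    unfolding disc_summable_def by (auto intro!: summable_mult summable_geometric)
  from disc_summable_add[OF this disc_summable_index[OF pCons(2)]]
  show ?case by simp
qed

section \<open>The operator z d/dz - a and Descartes' rule\<close>

lemma pser_has_field_derivative:
  assumes "disc_summable c" "\<bar>z\<bar> < 1"
  shows "(pser c has_field_derivative pser (diffs c) z) (at z)"
proof -
  have "((\<lambda>z. \<Sum>k. c k * z ^ k) has_field_derivative (\<Sum>k. diffs c k * z ^ k)) (at z)"
    by (rule termdiffs_strong'[of 1]) (use assms in \<open>auto intro: disc_summableD\<close>)
  thus ?thesis by (simp add: pser_def[abs_def])
qed

text \<open>On coefficients, z d/dz - a is multiplication by k - a. Zeros produced by Rolle's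
  theorem can thus be read as zeros of a series with modified coefficients.\<close>

lemma pser_shift:
  assumes "disc_summable c" "\<bar>z\<bar> < 1"
  shows "pser (\<lambda>k. (real k - a) * c k) z = z * pser (diffs c) z - a * pser c z"
proof -
  have "(\<lambda>k. real k * c k * z ^ k - a * (c k * z ^ k)) sums (z * pser (diffs c) z - a * pser c z)"
    unfolding pser_def[of c]
    by (intro sums_diff disc_summable_index_sums sums_mult summable_sums disc_summableD assms)
  thus ?thesis unfolding pser_def[of "\<lambda>k. (real k - a) * c k"]
    by (simp add: sums_iff algebra_simps)
qed

text \<open>Rolle's theorem for z^(-a) f(z): on the positive axis this function has the same zeros
  as f, and its derivative is z^(-a-1) times z f' - a f.\<close>

lemma rolle_euler_operator:
  fixes f f' :: "real \<Rightarrow> real"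
  assumes "0 < x" "x < y" "f x = 0" "f y = 0"
    and "\<And>z. x \<le> z \<Longrightarrow> z \<le> y \<Longrightarrow> (f has_field_derivative f' z) (at z)"
  shows "\<exists>z. x < z \<and> z < y \<and> z * f' z - a * f z = 0"
proof -
  let ?h = "\<lambda>z. z powr (- a) * f z"
  let ?h' = "\<lambda>z. z powr (- a - 1) * (z * f' z - a * f z)"
  have D: "(?h has_field_derivative ?h' z) (at z)" if "x \<le> z" "z \<le> y" for z
  proof -
    have z: "z > 0" using assms that by auto
    have *: "z powr (- a) = z powr (- a - 1) * z"
      using z by (simp add: powr_diff)
    show ?thesis
      by (rule derivative_eq_intros assms(5) that refl z)+ (simp add: * algebra_simps)
  qed
  have "\<exists>z>x. z < y \<and> ?h y - ?h x = (y - x) * ?h' z"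
    using assms(2) D by (intro MVT2) auto
  thus ?thesis using assms by auto
qed

text \<open>Rolle's theorem is applied between consecutive elements of \<open>X\<close>. The zeros
  obtained lie strictly inside the gaps, hence off \<open>X\<close>; this disjointness later yields
  simplicity.\<close>

lemma rolle_euler_operator_set:
  fixes f f' :: "real \<Rightarrow> real"
  assumes "finite X" "X \<noteq> {}" "X \<subseteq> {z. 0 < z \<and> z < R \<and> f z = 0}"
    and D: "\<And>z. 0 < z \<Longrightarrow> z < R \<Longrightarrow> (f has_field_derivative f' z) (at z)"
  shows "\<exists>Y. finite Y \<and> Suc (card Y) = card X \<and> Y \<inter> X = {} \<and> (\<forall>y\<in>Y. \<exists>x\<in>X. y < x) \<and>
           Y \<subseteq> {z. 0 < z \<and> z < R \<and> z * f' z - a * f z = 0}"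
  using assms(1-3)
proof (induction X rule: finite_linorder_max_induct)
  case (insert b X)
  show ?case
  proof (cases "X = {}")
    case True
    thus ?thesis by (intro exI[of _ "{}"]) auto
  next
    case False
    then obtain Y where Y: "finite Y" "Suc (card Y) = card X" "Y \<inter> X = {}" "\<forall>y\<in>Y. \<exists>x\<in>X. y < x"
      "Y \<subseteq> {z. 0 < z \<and> z < R \<and> z * f' z - a * f z = 0}"
      using insert by auto
    \<comment> \<open>The new maximum \<open>b\<close> adds the one gap between \<open>x\<close> and
      \<open>b\<close>. Every element of \<open>Y\<close> lies below \<open>x\<close>, so the zero
      found in this gap is new.\<close>
    define x where "x = Max X"
    have x: "x \<in> X" "\<And>u. u \<in> X \<Longrightarrow> u \<le> x"
      using False insert.hyps by (auto simp: x_def)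
    have xb: "0 < x" "x < b" "f x = 0" "f b = 0" "b < R"
      using x insert by auto
    then obtain z where z: "x < z" "z < b" "z * f' z - a * f z = 0"
      using rolle_euler_operator[of x b f f' a] D by force
    have zY: "z \<notin> Y" using Y(4) x(2) z(1) by force
    have "insert z Y \<inter> insert b X = {}"
      using Y(3,4) x(2) z insert.hyps(2) by force
    moreover have "\<forall>y\<in>insert z Y. \<exists>x\<in>insert b X. y < x"
      using Y(4) z by auto
    moreover have "Suc (card (insert z Y)) = card (insert b X)"
      using Y zY insert.hyps by auto
    moreover have "insert z Y \<subseteq> {z. 0 < z \<and> z < R \<and> z * f' z - a * f z = 0}"
      using Y(5) z xb by auto
    ultimately show ?thesis using Y(1) by (intro exI[of _ "insert z Y"]) auto
  qed
qed simp

text \<open>Induction on \<open>C\<close>: each factor k - a costs at most one zero, and the series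
  carrying all factors has none. In the equality case a multiple zero would also be a zero of the
  transformed series, besides those from Rolle's theorem, which is one too many.\<close>

lemma pser_descartes:
  assumes "finite C" "disc_summable c" "R \<le> 1"
    and "\<And>z. 0 < z \<Longrightarrow> z < R \<Longrightarrow> pser (\<lambda>k. (\<Prod>a\<in>C. real k - a) * c k) z \<noteq> 0"
    and "finite X" "X \<subseteq> {z. 0 < z \<and> z < R \<and> pser c z = 0}"
  shows "card X \<le> card C \<and> (card X = card C \<longrightarrow> (\<forall>x\<in>X. pser (diffs c) x \<noteq> 0))"
  using assms(1,2,4-6)
proof (induction C arbitrary: c X rule: finite_induct)
  case empty
  hence "X = {}" by (auto simp: subset_iff)
  thus ?case by simp
next
  case (insert a C)
  let ?c = "\<lambda>k. (real k - a) * c k"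
  let ?Z = "{z. 0 < z \<and> z < R \<and> pser ?c z = 0}"
  have eq: "pser ?c z = z * pser (diffs c) z - a * pser c z" if "0 < z" "z < R" for z
    using that assms(3) by (intro pser_shift insert) auto
  have IH: "card Y \<le> card C" if "finite Y" "Y \<subseteq> ?Z" for Y
  proof -
    have "pser (\<lambda>k. (\<Prod>a\<in>C. real k - a) * ?c k) z \<noteq> 0" if "0 < z" "z < R" for z
    proof -
      have "(\<lambda>k. (\<Prod>a\<in>C. real k - a) * ?c k) = (\<lambda>k. (\<Prod>a\<in>insert a C. real k - a) * c k)"
        using insert.hyps by (auto simp: fun_eq_iff)
      with insert.prems(2)[OF that] show ?thesis by metis
    qed
    with insert.IH[of ?c Y] that disc_summable_shift[OF insert.prems(1)] show ?thesis by blast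
  qed
  show ?case
  proof (cases "X = {}")
    case False
    have D: "(pser c has_field_derivative pser (diffs c) z) (at z)" if "0 < z" "z < R" for z
      using that assms(3) by (intro pser_has_field_derivative insert) auto
    obtain Y where Y: "finite Y" "Suc (card Y) = card X" "Y \<inter> X = {}"
      "Y \<subseteq> {z. 0 < z \<and> z < R \<and> z * pser (diffs c) z - a * pser c z = 0}"
      using rolle_euler_operator_set[of X R "pser c" "pser (diffs c)" a] False insert.prems D
      by blast
    have YZ: "Y \<subseteq> ?Z" using Y(4) eq by auto
    have le: "card Y \<le> card C" using IH[OF Y(1) YZ] .
    moreover have "pser (diffs c) x \<noteq> 0" if "card X = card (insert a C)" "x \<in> X" for x
    proof
      assume 0: "pser (diffs c) x = 0"
      have "0 < x" "x < R" "pser c x = 0" using that insert.prems by auto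
      with eq 0 have "x \<in> ?Z" by auto
      hence "card (insert x Y) \<le> card C" using YZ Y(1) by (intro IH) auto
      moreover have "x \<notin> Y" using Y(3) that by auto
      ultimately show False using that Y insert.hyps by auto
    qed
    ultimately show ?thesis using Y(2) insert.hyps by auto
  qed simp
qed

subsection \<open>The series of \<open>p\<^sub>n\<close>\<close>

lemma coeff_e_poly: "coeff (e_poly (int n)) j = fact j * real (Stirling n j)"
proof -
  have "coeff (e_poly (int n)) j = (\<Sum>i\<le>n. if i = j then fact i * real (Stirling n i) else 0)"
    by (simp add: e_poly_def coeff_sum)
  also have "\<dots> = fact j * real (Stirling n j)"
    by (cases "j \<le> n") auto
  finally show ?thesis .
qed

text \<open>Coefficientwise this is the recurrence S(n+1,j) = j S(n,j) + S(n,j-1) multiplied by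
  j!.\<close>

lemma e_poly_Suc: "e_poly (int (Suc n)) = [:0, 1:] * pderiv ([:1, 1:] * e_poly (int n))"
proof (rule poly_eqI)
  fix j
  show "coeff (e_poly (int (Suc n))) j = coeff ([:0, 1:] * pderiv ([:1, 1:] * e_poly (int n))) j"
    unfolding coeff_e_poly
    by (cases j) (simp_all add: coeff_e_poly coeff_pderiv algebra_simps)
qed

text \<open>The substitution y = x/(1+x) maps this half-line into the interval of convergence, which
  is why zeros are studied only to the right of -1/2.\<close>

lemma abs_moebius_less_one: "\<bar>x / (1 + x)\<bar> < 1" if "x > - 1 / 2" for x :: real
  using that by (auto simp: abs_less_iff field_simps)

lemma disc_summable_index_power: "disc_summable (\<lambda>k. real k ^ n)"
  using disc_summable_power_index[OF disc_summable_poly[of 1], of n] by simp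

lemma has_field_derivative_pser_moebius:
  assumes "disc_summable c" "x > - 1 / 2"
  shows "((\<lambda>x. pser c (x / (1 + x))) has_field_derivative
           pser (diffs c) (x / (1 + x)) / (1 + x) ^ 2) (at x)"
proof -
  have "((\<lambda>x. x / (1 + x)) has_field_derivative 1 / (1 + x) ^ 2) (at x)"
    using assms(2) by (auto intro!: derivative_eq_intros simp: power2_eq_square field_simps)
  from DERIV_chain2[OF pser_has_field_derivative[OF assms(1) abs_moebius_less_one[OF assms(2)]] this]
  show ?thesis by simp
qed

lemma poly_pderiv_eq_pser_moebius:
  assumes "disc_summable c" "x > - 1 / 2"
    and "\<And>x. x > - 1 / 2 \<Longrightarrow> poly q x = pser c (x / (1 + x))"
  shows "poly (pderiv q) x = pser (diffs c) (x / (1 + x)) / (1 + x) ^ 2"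
proof -
  have "((\<lambda>x. pser c (x / (1 + x))) has_field_derivative poly (pderiv q) x) (at x)"
    by (rule has_field_derivative_transform_within_open[OF poly_DERIV, of "{- 1 / 2<..}"])
       (use assms(2,3) in auto)
  from DERIV_unique[OF this has_field_derivative_pser_moebius[OF assms(1,2)]] show ?thesis .
qed

text \<open>As dy/dx = 1/(1+x)^2 for y = x/(1+x), the recurrence for e_n turns into z d/dz at z = y,
  which multiplies the k-th coefficient by k. The base case is the geometric series, with 0^0 =
  1.\<close>

lemma e_poly_series:
  assumes "x > - 1 / 2"
  shows "(1 + x) * poly (e_poly (int n)) x = pser (\<lambda>k. real k ^ n) (x / (1 + x))"
  using assms
proof (induction n arbitrary: x)
  case 0
  have "pser (\<lambda>k. real k ^ 0) (x / (1 + x)) = 1 / (1 - x / (1 + x))"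
    unfolding pser_def using suminf_geometric[of "x / (1 + x)"] abs_moebius_less_one[OF 0] by simp
  also have "\<dots> = 1 + x" using 0 by (simp add: field_simps)
  finally show ?case by (simp add: e_poly_def)
next
  case (Suc n)
  let ?y = "x / (1 + x)" and ?c = "\<lambda>k. real k ^ n"
  define q where "q = [:1, 1:] * e_poly (int n)"
  have q: "poly q x = pser ?c (x / (1 + x))" if "x > - 1 / 2" for x
    unfolding Suc.IH[OF that, symmetric] q_def by (simp add: algebra_simps)
  have "poly (pderiv q) x = pser (diffs ?c) ?y / (1 + x) ^ 2"
    by (rule poly_pderiv_eq_pser_moebius[OF disc_summable_index_power Suc.prems q])
  hence "(1 + x) * poly (e_poly (int (Suc n))) x = (1 + x) * (x * (pser (diffs ?c) ?y / (1 + x) ^ 2))"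
    unfolding e_poly_Suc q_def[symmetric] by simp
  also have "\<dots> = ?y * pser (diffs ?c) ?y"
    using Suc.prems by (simp add: power2_eq_square)
  also have "\<dots> = pser (\<lambda>k. real k ^ Suc n) ?y"
    using pser_shift[OF disc_summable_index_power[of n] abs_moebius_less_one[OF Suc.prems], of 0]
    by simp
  finally show ?case .
qed

text \<open>For n >= K and j <= K one has k^(n-j) = k^(K-j) k^(n-K), and summing \<gamma>_j k^(K-j)
  over j gives P(k).\<close>

lemma p_poly_series:
  assumes "x > - 1 / 2" "K \<le> n"
  shows "(1 + x) * poly (p_poly \<gamma> K n) x =
           pser (\<lambda>k. poly (P_poly \<gamma> K) (real k) * real k ^ (n - K)) (x / (1 + x))"
proof -
  let ?y = "x / (1 + x)"
  have "(1 + x) * poly (p_poly \<gamma> K n) x =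
          (\<Sum>j\<le>K. \<gamma> j * ((1 + x) * poly (e_poly (int (n - j))) x))"
    using assms(2) by (simp add: p_poly_def poly_sum sum_distrib_left of_nat_diff mult_ac)
  also have "\<dots> = (\<Sum>j\<le>K. \<gamma> j * pser (\<lambda>k. real k ^ (n - j)) ?y)"
    by (simp add: e_poly_series[OF assms(1)])
  finally have eq: "(1 + x) * poly (p_poly \<gamma> K n) x = \<dots>" .
  have "(\<lambda>k. \<Sum>j\<le>K. \<gamma> j * (real k ^ (n - j) * ?y ^ k)) sums
          (\<Sum>j\<le>K. \<gamma> j * pser (\<lambda>k. real k ^ (n - j)) ?y)"
    unfolding pser_def
    by (intro sums_sum sums_mult summable_sums disc_summableD disc_summable_index_power
          abs_moebius_less_one assms)
  moreover have "(\<Sum>j\<le>K. \<gamma> j * (real k ^ (n - j) * ?y ^ k)) =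
      poly (P_poly \<gamma> K) (real k) * real k ^ (n - K) * ?y ^ k" for k
  proof -
    have "(\<Sum>j\<le>K. \<gamma> j * (real k ^ (n - j) * ?y ^ k)) =
        (\<Sum>j\<le>K. \<gamma> j * real k ^ (K - j) * (real k ^ (n - K) * ?y ^ k))"
    proof (rule sum.cong[OF refl])
      fix j assume "j \<in> {..K}"
      hence "real k ^ (n - j) = real k ^ (K - j) * real k ^ (n - K)"
        using assms(2) by (simp flip: power_add)
      thus "\<gamma> j * (real k ^ (n - j) * ?y ^ k) =
          \<gamma> j * real k ^ (K - j) * (real k ^ (n - K) * ?y ^ k)"
        by (simp only: mult.assoc)
    qed
    also have "\<dots> = poly (P_poly \<gamma> K) (real k) * (real k ^ (n - K) * ?y ^ k)"
      by (simp only: P_poly_def poly_sum poly_monom sum_distrib_right)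
    finally show ?thesis by (simp only: mult.assoc)
  qed
  ultimately show ?thesis
    unfolding eq by (simp add: pser_def sums_iff)
qed

subsection \<open>Two dominant terms\<close>

text \<open>The N-th root of k^N z^k at z = (l/(l+1))^N. Its maximum over k tells which terms of the
  series dominate at this scale.\<close>

definition peak :: "nat \<Rightarrow> nat \<Rightarrow> real" where
  "peak l k = real k * (real l / real (l + 1)) ^ k"

lemma peak_pos: "0 < l \<Longrightarrow> 0 < k \<Longrightarrow> 0 < peak l k"
  by (simp add: peak_def)

lemma peak_nonneg: "0 \<le> peak l k"
  by (simp add: peak_def)

lemma peak_Suc: "real (l + 1) * peak l (Suc k) = (real l / real (l + 1)) ^ k * (real l * (real k + 1))"
proof -
  have "real (l + 1) * peak l (Suc k) =
      (real (l + 1) * (real l / real (l + 1))) * ((real k + 1) * (real l / real (l + 1)) ^ k)"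
    unfolding peak_def power_Suc by (simp only: of_nat_Suc mult_ac add.commute)
  also have "real (l + 1) * (real l / real (l + 1)) = real l"
    by simp
  finally show ?thesis by (simp only: mult_ac)
qed

lemma peak_Suc_self: "peak l (Suc l) = peak l l"
proof -
  have "real (l + 1) * peak l (Suc l) = real (l + 1) * peak l l"
    unfolding peak_Suc by (simp add: peak_def)
  thus ?thesis by simp
qed

text \<open>The increment from k to k + 1 is a positive multiple of l - k. Hence the values rise up
  to k = l, tie at l and l + 1, and fall afterwards.\<close>

lemma peak_less:
  assumes "0 < l" "k \<noteq> l" "k \<noteq> Suc l"
  shows "peak l k < peak l l"
proof -
  have step: "real (l + 1) * peak l (Suc k) - real (l + 1) * peak l k
      = (real l / real (l + 1)) ^ k * (real l - real k)" for k
    unfolding peak_Suc by (simp add: peak_def algebra_simps)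
  have up: "peak l k < peak l (Suc k)" if "k < l" for k
  proof -
    have "0 < (real l / real (l + 1)) ^ k * (real l - real k)"
      using that by simp
    with step[of k] have "real (l + 1) * peak l k < real (l + 1) * peak l (Suc k)" by linarith
    thus ?thesis by (simp only: mult_less_cancel_left_pos of_nat_0_less_iff)
  qed
  have down: "peak l (Suc k) < peak l k" if "l < k" for k
  proof -
    have "(real l / real (l + 1)) ^ k * (real l - real k) < 0"
      using that assms(1) by (intro mult_pos_neg) auto
    with step[of k] have "real (l + 1) * peak l (Suc k) < real (l + 1) * peak l k" by linarith
    thus ?thesis by (simp only: mult_less_cancel_left_pos of_nat_0_less_iff)
  qed
  show ?thesis
  proof (cases "k < l")
    case True
    hence "k \<le> l - 1" by simp
    hence "peak l k \<le> peak l (l - 1)"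
    proof (induction rule: inc_induct)
      case (step m)
      thus ?case using up[of m] by linarith
    qed simp
    thus ?thesis using up[of "l - 1"] True by simp
  next
    case False
    hence "Suc (Suc l) \<le> k" using assms by simp
    hence "peak l k \<le> peak l (Suc (Suc l))"
    proof (induction rule: dec_induct)
      case (step m)
      thus ?case using down[of m] by linarith
    qed simp
    thus ?thesis using down[of "Suc l"] by (simp add: peak_Suc_self)
  qed
qed

lemma tendsto_scale_0: "(\<lambda>N. u * (real l / real (l + 1)) ^ N) \<longlonglongrightarrow> 0"
  by (rule tendsto_mult_right_zero, rule LIMSEQ_power_zero) simp

lemma eventually_scale_less:
  "0 < a \<Longrightarrow> eventually (\<lambda>N. \<bar>u * (real l / real (l + 1)) ^ N\<bar> < a) sequentially"
  using tendsto_rabs_zero[OF tendsto_scale_0] order_tendstoD(2) by blast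

lemma index_power_mult_scale:
  "real k ^ N * (u * (real l / real (l + 1)) ^ N) ^ k = u ^ k * peak l k ^ N"
  by (simp add: peak_def power_mult_distrib mult_ac flip: power_mult)

text \<open>After division by \<open>peak l l ^ N\<close> the k-th term is c_k u^k r_k^N, where r_k
  <= 1 with equality only at l and l + 1. All other terms tend to 0, and Tannery's theorem exchanges
  limit and sum.\<close>

lemma pser_at_scale_limit:
  assumes "disc_summable c" "0 < l"
  shows "(\<lambda>N. pser (\<lambda>k. c k * real k ^ N) (u * (real l / real (l + 1)) ^ N) / peak l l ^ N)
           \<longlonglongrightarrow> c l * u ^ l + c (Suc l) * u ^ Suc l"
proof -
  define q where "q = real l / real (l + 1)"
  define r where "r k = peak l k / peak l l" for k
  have w: "0 < peak l l" using assms(2) by (rule peak_pos) fact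
  have r: "0 \<le> r k" "r k \<le> 1" for k
    using peak_less[OF assms(2), of k] w peak_nonneg[of l k]
    by (cases "k = l \<or> k = Suc l"; force simp: r_def peak_Suc_self)+
  define a where "a k N = c k * u ^ k * r k ^ N" for k N
  define b where "b k = (if k = l \<or> k = Suc l then c k * u ^ k else 0)" for k
  have lim: "(\<lambda>N. a k N) \<longlonglongrightarrow> b k" for k
  proof (cases "k = l \<or> k = Suc l")
    case True
    hence "r k = 1" using w by (auto simp: r_def peak_Suc_self)
    thus ?thesis using True by (simp add: a_def b_def)
  next
    case False
    hence "r k < 1" using peak_less[OF assms(2)] w by (simp add: r_def)
    hence "(\<lambda>N. c k * u ^ k * r k ^ N) \<longlonglongrightarrow> 0"
      using r[of k] by (intro tendsto_mult_right_zero LIMSEQ_power_zero) simp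
    thus ?thesis using False by (simp add: a_def b_def)
  qed
  \<comment> \<open>A single \<open>N0\<close> whose point lies in the disc gives a summable
    majorant for all later N, since the powers of \<open>r k\<close> decrease.\<close>
  obtain N0 where N0: "\<bar>u * q ^ N0\<bar> < 1"
    using eventually_happens'[OF _ eventually_scale_less[of 1 u l]] by (auto simp: q_def)
  define M where "M k = \<bar>c k * u ^ k\<bar> * r k ^ N0" for k
  have M_eq: "M k = \<bar>c k * real k ^ N0\<bar> * \<bar>u * q ^ N0\<bar> ^ k / peak l l ^ N0" for k
  proof -
    have "\<bar>c k * real k ^ N0\<bar> * \<bar>u * q ^ N0\<bar> ^ k = \<bar>c k\<bar> * \<bar>real k ^ N0 * (u * q ^ N0) ^ k\<bar>"
      by (simp add: abs_mult power_abs mult_ac)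
    also have "\<dots> = \<bar>c k * u ^ k\<bar> * peak l k ^ N0"
      unfolding q_def index_power_mult_scale by (simp add: abs_mult peak_nonneg mult_ac)
    finally show ?thesis by (simp add: M_def r_def power_divide)
  qed
  have "summable M"
    unfolding M_eq
    by (intro summable_divide disc_summable_abs disc_summable_power_index assms N0)
  moreover have "eventually (\<lambda>(k, N). norm (a k N) \<le> M k) (at_top \<times>\<^sub>F sequentially)"
  proof -
    have "norm (a k N) \<le> M k" if "N0 \<le> N" for k N
      using that r[of k] by (auto simp: a_def M_def abs_mult intro!: mult_left_mono power_decreasing)
    thus ?thesis
      using eventually_prodI[OF always_eventually[of "\<lambda>_. True"] eventually_ge_at_top[of N0], of at_top]
      by (auto elim!: eventually_mono)
  qed
  ultimately have "(\<lambda>N. suminf (\<lambda>k. a k N)) \<longlonglongrightarrow> suminf b"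
    using tannerys_theorem[of a b sequentially M] lim by simp
  also have "suminf b = c l * u ^ l + c (Suc l) * u ^ Suc l"
    by (subst suminf_finite[of "{l, Suc l}"]) (auto simp: b_def)
  finally show ?thesis
  proof (rule Lim_transform_eventually)
    show "eventually (\<lambda>N. suminf (\<lambda>k. a k N) =
        pser (\<lambda>k. c k * real k ^ N) (u * (real l / real (l + 1)) ^ N) / peak l l ^ N) sequentially"
      using eventually_scale_less[of 1 u l, OF zero_less_one]
    proof eventually_elim
      case (elim N)
      have "a k N = c k * real k ^ N * (u * (real l / real (l + 1)) ^ N) ^ k / peak l l ^ N" for k
        by (simp only: mult.assoc index_power_mult_scale a_def r_def) (simp add: power_divide)
      thus ?case
        unfolding pser_def
        by (simp only: suminf_divide[OF disc_summableD[OF disc_summable_power_index[OF assms(1)] elim]])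
    qed
  qed
qed

section \<open>Sign changes and the zeros they produce\<close>

definition sign_changes :: "(nat \<Rightarrow> real) \<Rightarrow> nat set" where
  "sign_changes c = {l. 0 < l \<and> c l * c (Suc l) < 0}"

text \<open>The nonzero solution z of c_l l^N z^l + c_(l+1) (l+1)^N z^(l+1) = 0, that is, the point
  where the two dominant terms cancel.\<close>

definition zero_scale :: "(nat \<Rightarrow> real) \<Rightarrow> nat \<Rightarrow> nat \<Rightarrow> real" where
  "zero_scale c l N = - (c l / c (Suc l)) * (real l / real (l + 1)) ^ N"

lemma sign_changes_ratio_pos: "l \<in> sign_changes c \<Longrightarrow> 0 < - (c l / c (Suc l))"
  by (auto simp: sign_changes_def mult_less_0_iff divide_pos_neg divide_neg_pos)

lemma zero_scale_pos: "l \<in> sign_changes c \<Longrightarrow> 0 < zero_scale c l N"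
  using sign_changes_ratio_pos[of l c] unfolding zero_scale_def
  by (intro mult_pos_pos zero_less_power) (auto simp: sign_changes_def)

lemma zero_near_scale:
  assumes "disc_summable c" "l \<in> sign_changes c" "0 < \<epsilon>" "\<epsilon> < 1"
  shows "eventually (\<lambda>N. \<exists>z. (1 - \<epsilon>) * zero_scale c l N < z \<and> z < (1 + \<epsilon>) * zero_scale c l N \<and>
           pser (\<lambda>k. c k * real k ^ N) z = 0) sequentially"
proof -
  define q where "q = real l / real (l + 1)"
  define t where "t = - (c l / c (Suc l))"
  have t: "0 < t" and l: "0 < l" and cl: "c l \<noteq> 0" "c (Suc l) \<noteq> 0"
    using sign_changes_ratio_pos[OF assms(2)] assms(2)
    by (auto simp: t_def sign_changes_def)
  let ?F = "\<lambda>N. pser (\<lambda>k. c k * real k ^ N)"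
  \<comment> \<open>At s > 0 times the predicted zero the limit has the sign of 1 - s, so the
    intermediate value theorem applies on both sides of s = 1. The extra factor \<open>c l\<close>
    makes this independent of the sign of \<open>c l\<close>.\<close>
  have lim: "(\<lambda>N. c l * (?F N (s * t * q ^ N) / peak l l ^ N))
               \<longlonglongrightarrow> (c l)\<^sup>2 * (s * t) ^ l * (1 - s)" for s
  proof -
    have ct: "c (Suc l) * t = - c l" using cl by (simp add: t_def)
    have "(c l)\<^sup>2 * (s * t) ^ l * (1 - s) = c l * ((s * t) ^ l * (c l + s * (- c l)))"
      by (simp add: power2_eq_square algebra_simps)
    also have "\<dots> = c l * (c l * (s * t) ^ l + c (Suc l) * (s * t) ^ Suc l)"
      unfolding ct[symmetric] by (simp add: algebra_simps)
    finally have *: "(c l)\<^sup>2 * (s * t) ^ l * (1 - s) = \<dots>" .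
    show ?thesis unfolding *
      unfolding q_def by (intro tendsto_mult_left pser_at_scale_limit assms l)
  qed
  have "eventually (\<lambda>N. c l * (?F N ((1 - \<epsilon>) * t * q ^ N) / peak l l ^ N) > 0) sequentially"
    by (rule order_tendstoD(1)[OF lim]) (use t cl assms in simp)
  moreover have "eventually (\<lambda>N. c l * (?F N ((1 + \<epsilon>) * t * q ^ N) / peak l l ^ N) < 0) sequentially"
    by (rule order_tendstoD(2)[OF lim]) (use t cl assms in \<open>simp add: mult_pos_neg\<close>)
  moreover have "eventually (\<lambda>N. \<bar>(1 + \<epsilon>) * t * q ^ N\<bar> < 1) sequentially"
    unfolding q_def by (rule eventually_scale_less) simp
  ultimately show ?thesis
  proof eventually_elim
    case (elim N)
    have w: "0 < peak l l ^ N" using peak_pos[OF l l] by simp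
    have qN: "0 < q ^ N" using l by (simp add: q_def)
    define x y where "x = (1 - \<epsilon>) * t * q ^ N" and "y = (1 + \<epsilon>) * t * q ^ N"
    have xy: "0 < x" "x \<le> y" "y < 1"
      using assms t qN elim(3) by (auto simp: x_def y_def)
    have sgn: "0 < c l * ?F N x" "c l * ?F N y < 0"
      using elim(1,2) w
    by (simp_all only: x_def y_def times_divide_eq_right zero_less_divide_iff divide_less_0_iff)
       (auto simp del: zero_less_power_eq power_less_zero_eq)
    have "continuous_on {x..y} (?F N)"
      by (rule DERIV_continuous_on[where D = "pser (diffs (\<lambda>k. c k * real k ^ N))"],
          rule has_field_derivative_at_within, rule pser_has_field_derivative)
         (use xy in \<open>auto intro: disc_summable_power_index assms\<close>)
    hence "\<exists>z\<ge>x. z \<le> y \<and> c l * ?F N z = 0"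
      using sgn xy by (intro IVT2' continuous_on_mult continuous_on_const) auto
    then obtain z where z: "x \<le> z" "z \<le> y" "c l * ?F N z = 0" by auto
    with sgn have "z \<noteq> x" "z \<noteq> y" by auto
    with z cl show ?case
      by (intro exI[of _ z]) (auto simp: x_def y_def zero_scale_def t_def q_def mult.assoc)
  qed
qed

subsection \<open>Localization of the zeros of the series\<close>

text \<open>Half-integer shifts never vanish at an integer, and the factor for l changes sign
  exactly between l and l + 1. The product runs over the image of \<open>T\<close> to match the set
  \<open>C\<close> in \<open>pser_descartes\<close>.\<close>

definition half_shift :: "nat set \<Rightarrow> (nat \<Rightarrow> real) \<Rightarrow> nat \<Rightarrow> real" where
  "half_shift T c k = (\<Prod>a\<in>(\<lambda>l. real l + 1 / 2) ` T. real k - a) * c k"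

lemma half_shift_eq: "half_shift T c k = (\<Prod>l\<in>T. real k - (real l + 1 / 2)) * c k"
  by (simp add: half_shift_def prod.reindex inj_on_def)

text \<open>The factors for l at k and k + 1 have opposite signs only if l = k. So membership of k
  in \<open>T\<close> flips the sign of the product of neighbours, and this happens precisely when
  that product was negative.\<close>

lemma half_shift_no_sign_change:
  assumes "finite T" "0 < k" "c k \<noteq> 0" "c (Suc k) \<noteq> 0" "k \<in> T \<longleftrightarrow> k \<in> sign_changes c"
  shows "0 < half_shift T c k * half_shift T c (Suc k)"
proof -
  define g where "g l = (real k - (real l + 1 / 2)) * (real (Suc k) - (real l + 1 / 2))" for l
  have pos: "0 < g l" if "l \<noteq> k" for l
  proof (cases "l < k")
    case True
    hence "real l + 1 \<le> real k" by simp
    thus ?thesis unfolding g_def by (intro mult_pos_pos) auto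
  next
    case False
    with that have "real k + 1 \<le> real l" by simp
    thus ?thesis unfolding g_def by (intro mult_neg_neg) auto
  qed
  have neg: "g k < 0" by (simp add: g_def)
  have eq: "half_shift T c k * half_shift T c (Suc k) = (\<Prod>l\<in>T. g l) * (c k * c (Suc k))"
    unfolding half_shift_eq g_def prod.distrib by (simp only: mult_ac)
  show ?thesis
  proof (cases "k \<in> T")
    case True
    have "(\<Prod>l\<in>T. g l) = g k * (\<Prod>l\<in>T - {k}. g l)"
      using assms(1) True by (rule prod.remove)
    also have "\<dots> < 0" using neg pos by (intro mult_neg_pos prod_pos) auto
    finally show ?thesis
      unfolding eq using assms True by (intro mult_neg_neg) (auto simp: sign_changes_def)
  next
    case False
    have "0 < (\<Prod>l\<in>T. g l)" by (rule prod_pos, rule pos) (use False in blast)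
    moreover have "\<not> c k * c (Suc k) < 0" "c k * c (Suc k) \<noteq> 0"
      using assms(2-5) False by (auto simp: sign_changes_def)
    hence "0 < c k * c (Suc k)" by linarith
    ultimately show ?thesis unfolding eq by (rule mult_pos_pos)
  qed
qed

section \<open>Ranges free of zeros\<close>

lemma same_sign_chain:
  fixes d :: "nat \<Rightarrow> real"
  assumes "d 1 \<noteq> 0" "\<And>k. 0 < k \<Longrightarrow> k < n \<Longrightarrow> 0 < d k * d (Suc k)" "0 < k" "k \<le> n"
  shows "0 < d 1 * d k"
  using assms(3,4)
proof (induction k rule: nat_induct_non_zero)
  case 1
  show ?case using assms(1) by (auto simp: zero_less_mult_iff neq_iff)
next
  case (Suc k)
  hence "0 < d 1 * d k" "0 < d k * d (Suc k)" using assms(2)[of k] by auto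
  thus ?case by (auto simp: zero_less_mult_iff)
qed

text \<open>All terms of positive index have one sign and that of index 1 is nonzero. The
  coefficient of index 0 may have any sign, but 0^N = 0 for N > 0 removes it.\<close>

lemma pser_same_sign_nonzero:
  assumes "disc_summable d" "\<And>k. 0 < k \<Longrightarrow> 0 < d 1 * d k" "0 < N" "0 < z" "z < 1"
  shows "pser (\<lambda>k. d k * real k ^ N) z \<noteq> 0"
proof -
  have s: "(\<lambda>k. d 1 * (d k * real k ^ N * z ^ k)) sums (d 1 * pser (\<lambda>k. d k * real k ^ N) z)"
    unfolding pser_def
    by (intro sums_mult summable_sums disc_summableD disc_summable_power_index assms)
       (use assms in auto)
  have nonneg: "0 \<le> d 1 * (d k * real k ^ N * z ^ k)" for k
  proof (cases "k = 0")
    case False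
    hence "0 \<le> (d 1 * d k) * (real k ^ N * z ^ k)"
      using assms(2)[of k] assms(4) False by (intro mult_nonneg_nonneg[OF less_imp_le]) auto
    thus ?thesis by (simp only: mult_ac)
  qed (use assms in \<open>auto simp: zero_power\<close>)
  have "0 < d 1 * pser (\<lambda>k. d k * real k ^ N) z"
    using suminf_pos2[OF sums_summable[OF s] nonneg, of 1] assms(2)[of 1] assms(4) s
    by (simp add: sums_iff mult.assoc[symmetric])
  thus ?thesis by auto
qed

text \<open>In this range of \<open>z\<close> the term of index \<open>Suc g\<close> dominates the sum of all later ones.\<close>

lemma pser_initial_sign_nonzero:
  assumes d: "disc_summable d" and g: "0 < g" and A: "0 < A"
    and sign: "\<And>k. 0 < k \<Longrightarrow> k \<le> Suc g \<Longrightarrow> 0 < d 1 * d k"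
  shows "eventually (\<lambda>N. \<forall>z. 0 < z \<and> z < A * (real g / real (g + 1)) ^ N \<longrightarrow>
           pser (\<lambda>k. d k * real k ^ N) z \<noteq> 0) sequentially"
proof -
  \<comment> \<open>The tail in absolute value. Its coefficients at g and g + 1, the dominant
    indices at this scale, are 0, so the normalized tail tends to 0.\<close>
  define e where "e k = (if Suc g < k then \<bar>d 1 * d k\<bar> else 0)" for k
  have e: "disc_summable e"
    by (rule disc_summable_abs_le[OF disc_summable_cmult[OF d, of "d 1"]]) (simp add: e_def)
  define L where "L = d 1 * d (Suc g) * A ^ Suc g"
  have L: "0 < L" using sign[of "Suc g"] A by (simp add: L_def)
  have "(\<lambda>N. pser (\<lambda>k. e k * real k ^ N) (A * (real g / real (g + 1)) ^ N) / peak g g ^ N) \<longlonglongrightarrow> 0"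
    using pser_at_scale_limit[OF e g, of A] by (simp add: e_def)
  from order_tendstoD(2)[OF this L]
  have "eventually (\<lambda>N. pser (\<lambda>k. e k * real k ^ N) (A * (real g / real (g + 1)) ^ N) / peak g g ^ N < L)
      sequentially" .
  thus ?thesis
    using eventually_scale_less[of 1 A g, OF zero_less_one] eventually_gt_at_top[of 0]
  proof eventually_elim
    case (elim N)
    define Z where "Z = A * (real g / real (g + 1)) ^ N"
    have Z: "0 < Z" "Z < 1" using A g elim(2) by (auto simp: Z_def)
    have w: "0 < peak g g ^ N" using peak_pos[OF g g] by (rule zero_less_power)
    have eL: "pser (\<lambda>k. e k * real k ^ N) Z < L * peak g g ^ N"
      using elim(1) w by (simp only: Z_def pos_divide_less_eq)
    have LZ: "L * peak g g ^ N = d 1 * d (Suc g) * (real (Suc g) ^ N * Z ^ Suc g)"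
      unfolding Z_def index_power_mult_scale peak_Suc_self by (simp add: L_def)
    show ?case
    proof (intro allI impI)
      fix z assume "0 < z \<and> z < A * (real g / real (g + 1)) ^ N"
      hence z: "0 < z" "z < Z" by (auto simp: Z_def)
      \<comment> \<open>Moving from \<open>Z\<close> down to \<open>z\<close> multiplies the term of
        index g + 1 by \<open>\<theta>\<close> and every later term by at most
        \<open>\<theta>\<close>, so the comparison made once at \<open>Z\<close> holds for all
        smaller z.\<close>
      define \<theta> where "\<theta> = (z / Z) ^ Suc g"
      have \<theta>: "0 < \<theta>" using z Z by (simp add: \<theta>_def)
      let ?f = "\<lambda>k. d 1 * (d k * real k ^ N * z ^ k)"
      let ?h = "\<lambda>k. \<theta> * ((if k = Suc g then L * peak g g ^ N else 0) - e k * real k ^ N * Z ^ k)"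
      have f: "?f sums (d 1 * pser (\<lambda>k. d k * real k ^ N) z)"
        unfolding pser_def
        by (intro sums_mult summable_sums disc_summableD disc_summable_power_index d)
           (use z Z in auto)
      have h: "?h sums (\<theta> * (L * peak g g ^ N - pser (\<lambda>k. e k * real k ^ N) Z))"
        unfolding pser_def
        by (intro sums_mult sums_diff sums_single summable_sums disc_summableD
              disc_summable_power_index e) (use Z in auto)
      \<comment> \<open>The minorant drops the nonnegative terms up to g, keeps the term g + 1
        exactly, and replaces later terms by minus \<open>\<theta>\<close> times their absolute
        value at \<open>Z\<close>.\<close>
      have hf: "?h k \<le> ?f k" for k
      proof -
        consider "k = 0" | "0 < k" "k \<le> g" | "k = Suc g" | "Suc g < k" by linarith
        thus ?thesis
        proof cases
          case 1
          thus ?thesis using elim(3) by (simp add: e_def zero_power)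
        next
          case 2
          have "0 \<le> (d 1 * d k) * (real k ^ N * z ^ k)"
            using sign[of k] 2 z by (intro mult_nonneg_nonneg[OF less_imp_le]) auto
          thus ?thesis using 2 by (simp add: e_def mult_ac)
        next
          case 3
          have "\<theta> * Z ^ Suc g = z ^ Suc g" using Z by (simp add: \<theta>_def power_divide)
          moreover have "\<theta> * (d 1 * d (Suc g) * (real (Suc g) ^ N * Z ^ Suc g)) =
              d 1 * (d (Suc g) * real (Suc g) ^ N * (\<theta> * Z ^ Suc g))" by (simp only: mult_ac)
          ultimately have "?h (Suc g) = ?f (Suc g)" unfolding LZ by (simp add: e_def)
          thus ?thesis unfolding 3 by (rule eq_refl)
        next
          case 4
          have "(z / Z) ^ k \<le> \<theta>"
            unfolding \<theta>_def using z Z 4 by (intro power_decreasing) auto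
          hence "z ^ k \<le> \<theta> * Z ^ k" using Z by (simp add: power_divide pos_divide_le_eq)
          hence "\<bar>d 1 * d k\<bar> * real k ^ N * z ^ k \<le> \<bar>d 1 * d k\<bar> * real k ^ N * (\<theta> * Z ^ k)"
            by (intro mult_left_mono) auto
          moreover have "- (d 1 * d k * (real k ^ N * z ^ k)) \<le> \<bar>d 1 * d k\<bar> * real k ^ N * z ^ k"
            using mult_right_mono[OF abs_ge_minus_self[of "d 1 * d k"], of "real k ^ N * z ^ k"] z
            by (simp add: mult.assoc)
          moreover have "?h k = - (\<bar>d 1 * d k\<bar> * real k ^ N * (\<theta> * Z ^ k))"
            using 4 by (simp add: e_def mult_ac)
          moreover have "?f k = d 1 * d k * (real k ^ N * z ^ k)"
            by (simp only: mult_ac)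
          ultimately show ?thesis by linarith
        qed
      qed
      have "0 < \<theta> * (L * peak g g ^ N - pser (\<lambda>k. e k * real k ^ N) Z)"
        using \<theta> eL by simp
      also have "\<dots> \<le> d 1 * pser (\<lambda>k. d k * real k ^ N) z"
        by (rule sums_le[OF hf h f])
      finally show "pser (\<lambda>k. d k * real k ^ N) z \<noteq> 0" by auto
    qed
  qed
qed

text \<open>The bases l/(l+1) increase strictly with l, so the quotient of the two scales decays
  geometrically and beats any constants.\<close>

lemma zero_scale_separated:
  assumes "l \<in> sign_changes c" "l' \<in> sign_changes c" "l < l'" "0 < b"
  shows "eventually (\<lambda>N. a * zero_scale c l N < b * zero_scale c l' N) sequentially"
proof -
  define q where "q l = real l / real (l + 1)" for l
  have q: "0 < q l" "0 < q l'" "q l < q l'"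
    using assms by (auto simp: q_def sign_changes_def field_simps)
  have \<tau>: "0 < - (c l / c (Suc l))" "0 < - (c l' / c (Suc l'))"
    using sign_changes_ratio_pos assms by blast+
  have "(\<lambda>N. a * (- (c l / c (Suc l))) * (q l / q l') ^ N) \<longlonglongrightarrow> 0"
    using q by (intro tendsto_mult_right_zero LIMSEQ_power_zero) auto
  moreover have "0 < b * (- (c l' / c (Suc l')))"
    using \<tau> assms by (intro mult_pos_pos)
  ultimately have "eventually (\<lambda>N. a * (- (c l / c (Suc l))) * (q l / q l') ^ N <
      b * (- (c l' / c (Suc l')))) sequentially"
    by (rule order_tendstoD(2))
  thus ?thesis
  proof eventually_elim
    case (elim N)
    have "a * (- (c l / c (Suc l))) * (q l / q l') ^ N * q l' ^ N < b * (- (c l' / c (Suc l'))) * q l' ^ N"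
      using elim q by (intro mult_strict_right_mono) auto
    moreover have "(q l / q l') ^ N * q l' ^ N = q l ^ N" using q by (simp add: power_divide)
    ultimately show ?case unfolding zero_scale_def q_def[symmetric] by (metis mult.assoc)
  qed
qed

text \<open>Common interface for the two choices of \<open>T\<close>: all sign changes with R = 1,
  or those up to some g with R = 2 \<open>zero_scale c g\<close>. The factor 2 leaves room for
  windows of relative width \<epsilon> < 1 around the scales.\<close>

definition sign_isolating :: "(nat \<Rightarrow> real) \<Rightarrow> nat set \<Rightarrow> (nat \<Rightarrow> real) \<Rightarrow> bool" where
  "sign_isolating c T R \<longleftrightarrow>
     eventually (\<lambda>N. R N \<le> 1 \<and> (\<forall>l\<in>T. 2 * zero_scale c l N \<le> R N) \<and>
       (\<forall>z. 0 < z \<and> z < R N \<longrightarrow> pser (\<lambda>k. half_shift T c k * real k ^ N) z \<noteq> 0)) sequentially"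

lemma zero_scale_tendsto_0: "zero_scale c l \<longlonglongrightarrow> 0"
  unfolding zero_scale_def[abs_def] by (rule tendsto_scale_0)

lemma disc_summable_half_shift: "finite T \<Longrightarrow> disc_summable c \<Longrightarrow> disc_summable (half_shift T c)"
  unfolding half_shift_def[abs_def] by (intro disc_summable_prod_shift) auto

lemma half_shift_same_sign:
  assumes "finite T" "\<And>k. 0 < k \<Longrightarrow> c k \<noteq> 0"
    and "\<And>k. 0 < k \<Longrightarrow> k < n \<Longrightarrow> k \<in> T \<longleftrightarrow> k \<in> sign_changes c" "0 < k" "k \<le> n" "1 < n"
  shows "0 < half_shift T c 1 * half_shift T c k"
proof (rule same_sign_chain[OF _ _ assms(4,5)])
  show step: "0 < half_shift T c k * half_shift T c (Suc k)" if "0 < k" "k < n" for k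
    using that assms by (intro half_shift_no_sign_change) auto
  show "half_shift T c 1 \<noteq> 0" using step[of 1] assms(6) by auto
qed

lemma sign_isolating_all:
  assumes "disc_summable c" "\<And>k. 0 < k \<Longrightarrow> c k \<noteq> 0" "finite (sign_changes c)"
  shows "sign_isolating c (sign_changes c) (\<lambda>_. 1)"
proof -
  have "eventually (\<lambda>N. \<forall>l\<in>sign_changes c. zero_scale c l N < 1 / 2) sequentially"
    using assms(3) by (intro eventually_ball_finite ballI order_tendstoD(2)[OF zero_scale_tendsto_0]) auto
  thus ?thesis unfolding sign_isolating_def using eventually_gt_at_top[of 0]
  proof eventually_elim
    case (elim N)
    have "0 < half_shift (sign_changes c) c 1 * half_shift (sign_changes c) c k" if "0 < k" for k
      by (rule half_shift_same_sign[where n = "Suc k"]) (use assms that in auto)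
    hence "pser (\<lambda>k. half_shift (sign_changes c) c k * real k ^ N) z \<noteq> 0" if "0 < z" "z < 1" for z
      using that elim assms by (intro pser_same_sign_nonzero disc_summable_half_shift)
    thus ?case using elim(1) by force
  qed
qed

text \<open>Removing the sign changes up to and including g makes the signs agree through index g +
  1, as \<open>pser_initial_sign_nonzero\<close> requires. This also works when there are infinitely
  many sign changes.\<close>

lemma sign_isolating_initial:
  assumes "disc_summable c" "\<And>k. 0 < k \<Longrightarrow> c k \<noteq> 0" "g \<in> sign_changes c"
  shows "sign_isolating c {l \<in> sign_changes c. l \<le> g} (\<lambda>N. 2 * zero_scale c g N)"
proof -
  let ?T = "{l \<in> sign_changes c. l \<le> g}"
  have T: "finite ?T" by simp
  have "eventually (\<lambda>N. zero_scale c g N < 1 / 2) sequentially"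
    by (rule order_tendstoD(2)[OF zero_scale_tendsto_0]) simp
  moreover have "eventually (\<lambda>N. \<forall>l\<in>?T. zero_scale c l N \<le> zero_scale c g N) sequentially"
  proof (intro eventually_ball_finite ballI T)
    fix l assume l: "l \<in> ?T"
    show "eventually (\<lambda>N. zero_scale c l N \<le> zero_scale c g N) sequentially"
    proof (cases "l = g")
      case False
      with l have "l \<in> sign_changes c" "l < g" by auto
      from zero_scale_separated[OF this(1) assms(3) this(2), of 1 1] show ?thesis
        by (auto elim: eventually_mono)
    qed auto
  qed
  moreover have "eventually (\<lambda>N. \<forall>z. 0 < z \<and> z < 2 * zero_scale c g N \<longrightarrow>
      pser (\<lambda>k. half_shift ?T c k * real k ^ N) z \<noteq> 0) sequentially"
    unfolding zero_scale_def mult.assoc[symmetric]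
  proof (rule pser_initial_sign_nonzero)
    show "disc_summable (half_shift ?T c)" by (rule disc_summable_half_shift[OF T assms(1)])
    show "0 < 2 * (- (c g / c (Suc g)))" using sign_changes_ratio_pos[OF assms(3)] by simp
    show g: "0 < g" using assms(3) by (simp add: sign_changes_def)
    show "0 < half_shift ?T c 1 * half_shift ?T c k" if "0 < k" "k \<le> Suc g" for k
      by (rule half_shift_same_sign[where n = "Suc g"]) (use that assms(2) g in auto)
  qed
  ultimately show ?thesis unfolding sign_isolating_def
    by eventually_elim auto
qed

text \<open>The intermediate value theorem gives one zero for each element of \<open>T\<close>, and
  Descartes' bound allows no more below R. Since the bound is attained, its equality case shows that
  the zeros are simple.\<close>

lemma zeros_localized:
  assumes c: "disc_summable c" and T: "finite T" "T \<subseteq> sign_changes c" and \<epsilon>: "0 < \<epsilon>" "\<epsilon> < 1"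
    and R: "sign_isolating c T R"
  shows "eventually (\<lambda>N. \<exists>\<zeta>. strict_mono_on T \<zeta> \<and>
           (\<forall>l\<in>T. \<bar>\<zeta> l / zero_scale c l N - 1\<bar> < \<epsilon>) \<and>
           {z. 0 < z \<and> z < R N \<and> pser (\<lambda>k. c k * real k ^ N) z = 0} = \<zeta> ` T \<and>
           (\<forall>l\<in>T. pser (diffs (\<lambda>k. c k * real k ^ N)) (\<zeta> l) \<noteq> 0)) sequentially"
proof -
  have "eventually (\<lambda>N. \<forall>l\<in>T. \<exists>z. (1 - \<epsilon>) * zero_scale c l N < z \<and>
      z < (1 + \<epsilon>) * zero_scale c l N \<and> pser (\<lambda>k. c k * real k ^ N) z = 0) sequentially"
    using T c \<epsilon> by (intro eventually_ball_finite ballI zero_near_scale) auto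
  \<comment> \<open>The windows belonging to different l are eventually disjoint and ordered, so the
    zeros chosen in them increase with l.\<close>
  moreover have "eventually (\<lambda>N. \<forall>l\<in>T. \<forall>l'\<in>T. l < l' \<longrightarrow>
      (1 + \<epsilon>) * zero_scale c l N < (1 - \<epsilon>) * zero_scale c l' N) sequentially"
  proof (intro eventually_ball_finite ballI T)
    fix l l' assume "l \<in> T" "l' \<in> T"
    thus "eventually (\<lambda>N. l < l' \<longrightarrow>
        (1 + \<epsilon>) * zero_scale c l N < (1 - \<epsilon>) * zero_scale c l' N) sequentially"
      using T \<epsilon> by (cases "l < l'") (auto intro!: zero_scale_separated)
  qed
  ultimately show ?thesis using R[unfolded sign_isolating_def]
  proof eventually_elim
    case (elim N)
    let ?c = "\<lambda>k. c k * real k ^ N" and ?C = "(\<lambda>l. real l + 1 / 2) ` T"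
    let ?Z = "{z. 0 < z \<and> z < R N \<and> pser ?c z = 0}"
    obtain \<zeta> where \<zeta>: "\<And>l. l \<in> T \<Longrightarrow> (1 - \<epsilon>) * zero_scale c l N < \<zeta> l"
      "\<And>l. l \<in> T \<Longrightarrow> \<zeta> l < (1 + \<epsilon>) * zero_scale c l N" "\<And>l. l \<in> T \<Longrightarrow> pser ?c (\<zeta> l) = 0"
      using elim(1) by metis
    have t: "0 < zero_scale c l N" if "l \<in> T" for l
      using zero_scale_pos T that by blast
    have mono: "strict_mono_on T \<zeta>"
    proof (rule strict_mono_onI)
      fix l l' assume "l \<in> T" "l' \<in> T" "l < l'"
      with elim(2) \<zeta>(2)[of l] \<zeta>(1)[of l'] show "\<zeta> l < \<zeta> l'" by fastforce
    qed
    have cardT: "card (\<zeta> ` T) = card ?C"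
      using card_image[OF strict_mono_on_imp_inj_on[OF mono]]
      by (subst card_image) (auto simp: inj_on_def)
    have sub: "\<zeta> ` T \<subseteq> ?Z"
    proof (intro image_subsetI CollectI conjI)
      fix l assume l: "l \<in> T"
      have "0 \<le> (1 - \<epsilon>) * zero_scale c l N" using t[OF l] \<epsilon> by simp
      thus "0 < \<zeta> l" using \<zeta>(1)[OF l] by linarith
      have "(1 + \<epsilon>) * zero_scale c l N \<le> 2 * zero_scale c l N" using t[OF l] \<epsilon> by simp
      thus "\<zeta> l < R N" using \<zeta>(2)[OF l] elim(3) l by force
      show "pser ?c (\<zeta> l) = 0" by (rule \<zeta>(3)[OF l])
    qed
    have nz: "pser (\<lambda>k. (\<Prod>a\<in>?C. real k - a) * ?c k) z \<noteq> 0" if "0 < z" "z < R N" for z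
      using elim(3) that by (simp add: half_shift_def mult.assoc)
    have D: "card X \<le> card ?C \<and> (card X = card ?C \<longrightarrow> (\<forall>x\<in>X. pser (diffs ?c) x \<noteq> 0))"
      if "finite X" "X \<subseteq> ?Z" for X
      by (rule pser_descartes[OF _ _ _ nz that]) (use T c elim(3) in \<open>auto intro: disc_summable_power_index\<close>)
    have "?Z \<subseteq> \<zeta> ` T"
    proof
      fix z assume z: "z \<in> ?Z"
      show "z \<in> \<zeta> ` T"
      proof (rule ccontr)
        assume "z \<notin> \<zeta> ` T"
        moreover have "card (insert z (\<zeta> ` T)) \<le> card ?C"
          using D[of "insert z (\<zeta> ` T)"] T sub z by auto
        moreover have "finite (\<zeta> ` T)" using T by simp
        ultimately show False using cardT card_insert_disjoint[of "\<zeta> ` T" z] by linarith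
      qed
    qed
    hence "?Z = \<zeta> ` T" using sub by blast
    moreover have "\<forall>l\<in>T. pser (diffs ?c) (\<zeta> l) \<noteq> 0"
      using D[OF finite_imageI[OF T(1)] sub] cardT by simp
    moreover have "\<forall>l\<in>T. \<bar>\<zeta> l / zero_scale c l N - 1\<bar> < \<epsilon>"
    proof
      fix l assume l: "l \<in> T"
      have "1 - \<epsilon> < \<zeta> l / zero_scale c l N" "\<zeta> l / zero_scale c l N < 1 + \<epsilon>"
        using \<zeta>(1,2)[OF l] t[OF l] by (simp_all add: pos_less_divide_eq pos_divide_less_eq)
      thus "\<bar>\<zeta> l / zero_scale c l N - 1\<bar> < \<epsilon>" by linarith
    qed
    ultimately show ?case using mono by blast
  qed
qed

subsection \<open>From the series to the polynomials\<close>

text \<open>\<open>M\<close> splits into the values of \<open>f\<close>, each once, and a rest lying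
  above all of them, so its sorted list is the concatenation of the two sorted lists.\<close>

lemma sorted_list_of_multiset_initial:
  fixes M :: "real multiset"
  assumes mono: "strict_mono_on {..<m} f" and count: "\<And>i. i < m \<Longrightarrow> count M (f i) = 1"
    and initial: "\<And>x i. x \<in># M \<Longrightarrow> i < m \<Longrightarrow> x \<le> f i \<Longrightarrow> x \<in> f ` {..<m}"
  shows "m \<le> length (sorted_list_of_multiset M) \<and>
           (\<forall>i<m. sorted_list_of_multiset M ! i = f i)"
proof -
  define xs where "xs = map f [0..<m]"
  define rest where "rest = filter_mset (\<lambda>x. x \<notin> f ` {..<m}) M"
  have set_xs: "set xs = f ` {..<m}" by (auto simp: xs_def)
  have "distinct xs"
    unfolding xs_def distinct_map
    using strict_mono_on_imp_inj_on[OF mono] by (simp add: atLeast0LessThan)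
  hence "mset xs = mset_set (f ` {..<m})" by (metis mset_set_set set_xs)
  hence "M = mset xs + rest"
    by (auto intro!: multiset_eqI simp: rest_def count_mset_set' count)
  hence M: "mset (xs @ sorted_list_of_multiset rest) = M" by simp
  have "sorted xs"
    unfolding sorted_iff_nth_mono_less xs_def
    using strict_mono_onD[OF mono] by (auto intro: less_imp_le)
  moreover have "x \<le> y" if "x \<in> set xs" "y \<in> set (sorted_list_of_multiset rest)" for x y
    using that initial[of y] by (force simp: xs_def rest_def)
  ultimately have "sorted (xs @ sorted_list_of_multiset rest)" by (simp add: sorted_append)
  hence "sorted_list_of_multiset M = xs @ sorted_list_of_multiset rest"
    by (metis M sorted_list_of_multiset_mset sorted_sort_id)
  thus ?thesis by (simp add: xs_def nth_append)
qed

text \<open>For \<sigma> = 1 or -1 these are the moduli of the zeros of sign \<sigma>. Increasing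
  moduli match both the increasing order of positive zeros and the decreasing order of negative
  ones.\<close>

definition abs_zeros :: "real \<Rightarrow> real poly \<Rightarrow> real list" where
  "abs_zeros \<sigma> p =
     sorted_list_of_multiset (image_mset ((*) \<sigma>) (filter_mset (\<lambda>x. 0 < \<sigma> * x) (proots p)))"

lemma pos_zeros_eq: "pos_zeros p = abs_zeros 1 p"
proof -
  have "(*) (1 :: real) = id" by auto
  thus ?thesis by (simp add: pos_zeros_def abs_zeros_def)
qed

lemma neg_zeros_eq: "neg_zeros p = map uminus (abs_zeros (-1) p)"
proof -
  define M where "M = filter_mset (\<lambda>x. x < 0) (proots p)"
  let ?ys = "map uminus (rev (sorted_list_of_multiset M))"
  have "sorted ?ys" by (simp add: sorted_map sorted_wrt_rev)
  moreover have "mset ?ys = image_mset ((*) (-1)) M"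
    by (simp add: mset_map) (simp add: fun_eq_iff cong: image_mset_cong)
  ultimately have "sorted_list_of_multiset (image_mset ((*) (-1)) M) = ?ys"
    by (metis sorted_list_of_multiset_mset sorted_sort_id)
  thus ?thesis by (simp add: neg_zeros_def abs_zeros_def M_def o_def)
qed

section \<open>Reflection and transfer of simple zeros\<close>

lemma pser_signed: "pser (\<lambda>k. c k * \<sigma> ^ k) z = pser c (\<sigma> * z)"
  by (simp add: pser_def power_mult_distrib mult.assoc)

lemma diffs_signed: "diffs (\<lambda>k. c k * \<sigma> ^ k) = (\<lambda>k. \<sigma> * (diffs c k * \<sigma> ^ k))"
  for c :: "nat \<Rightarrow> real"
  by (simp add: diffs_def fun_eq_iff mult_ac)

lemma pser_diffs_signed:
  assumes "disc_summable c" "\<bar>\<sigma> * z\<bar> < 1"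
  shows "pser (diffs (\<lambda>k. c k * \<sigma> ^ k)) z = \<sigma> * pser (diffs c) (\<sigma> * z)"
proof -
  have "pser (\<lambda>k. \<sigma> * (diffs c k * \<sigma> ^ k)) z = (\<Sum>k. \<sigma> * (diffs c k * (\<sigma> * z) ^ k))"
    by (simp add: pser_def power_mult_distrib mult.assoc)
  also have "\<dots> = \<sigma> * pser (diffs c) (\<sigma> * z)"
    unfolding pser_def by (intro suminf_mult disc_summableD disc_summable_diffs assms)
  finally show ?thesis by (simp add: diffs_signed)
qed

lemma order_eq_1:
  fixes p :: "real poly"
  assumes "poly p x = 0" "poly (pderiv p) x \<noteq> 0"
  shows "order x p = 1"
proof -
  have "p \<noteq> 0" using assms(2) by auto
  from order_pderiv[OF this assms(1)] show ?thesis
    using assms(2) by (simp add: order_0I)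
qed

definition signed_coeff :: "real poly \<Rightarrow> real \<Rightarrow> nat \<Rightarrow> real" where
  "signed_coeff P \<sigma> k = poly P (real k) * \<sigma> ^ k"

lemma disc_summable_signed_coeff: "\<bar>\<sigma>\<bar> = 1 \<Longrightarrow> disc_summable (signed_coeff P \<sigma>)"
  by (rule disc_summable_abs_le[OF disc_summable_poly[of P]])
     (simp add: signed_coeff_def abs_mult power_abs)

lemma p_poly_zero_iff:
  assumes "x > - 1 / 2" "K \<le> n" "\<bar>\<sigma>\<bar> = 1"
  shows "poly (p_poly \<gamma> K n) x = 0 \<longleftrightarrow>
    pser (\<lambda>k. signed_coeff (P_poly \<gamma> K) \<sigma> k * real k ^ (n - K)) (\<sigma> * (x / (1 + x))) = 0"
proof -
  have \<sigma>: "\<sigma> * \<sigma> = 1" using assms(3) by (auto simp: abs_if split: if_splits)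
  have "pser (\<lambda>k. signed_coeff (P_poly \<gamma> K) \<sigma> k * real k ^ (n - K)) (\<sigma> * (x / (1 + x))) =
      pser (\<lambda>k. poly (P_poly \<gamma> K) (real k) * real k ^ (n - K) * \<sigma> ^ k) (\<sigma> * (x / (1 + x)))"
    by (simp only: signed_coeff_def mult_ac)
  also have "\<dots> = pser (\<lambda>k. poly (P_poly \<gamma> K) (real k) * real k ^ (n - K)) (x / (1 + x))"
    unfolding pser_signed mult.assoc[symmetric] \<sigma> by simp
  also have "\<dots> = (1 + x) * poly (p_poly \<gamma> K n) x"
    by (rule p_poly_series[OF assms(1,2), symmetric])
  finally show ?thesis using assms(1) by simp
qed

text \<open>At a zero of p_n the derivative of (1+x) p_n is (1+x) p_n', so a nonzero derivative of
  the series forces p_n' to be nonzero.\<close>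

lemma p_poly_simple_zero:
  assumes x: "x > - 1 / 2" and n: "K \<le> n" and \<sigma>: "\<bar>\<sigma>\<bar> = 1"
    and zero: "poly (p_poly \<gamma> K n) x = 0"
    and nz: "pser (diffs (\<lambda>k. signed_coeff (P_poly \<gamma> K) \<sigma> k * real k ^ (n - K))) (\<sigma> * (x / (1 + x))) \<noteq> 0"
  shows "p_poly \<gamma> K n \<noteq> 0 \<and> order x (p_poly \<gamma> K n) = 1"
proof -
  let ?p = "p_poly \<gamma> K n" and ?y = "x / (1 + x)"
  let ?c = "\<lambda>k. poly (P_poly \<gamma> K) (real k) * real k ^ (n - K)"
  have c: "disc_summable ?c" by (intro disc_summable_power_index disc_summable_poly)
  have \<sigma>2: "\<sigma> * \<sigma> = 1" using \<sigma> by (auto simp: abs_if split: if_splits)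
  have "(\<lambda>k. signed_coeff (P_poly \<gamma> K) \<sigma> k * real k ^ (n - K)) = (\<lambda>k. ?c k * \<sigma> ^ k)"
    by (simp only: signed_coeff_def mult_ac)
  moreover have "\<bar>\<sigma> * (\<sigma> * ?y)\<bar> < 1"
    unfolding mult.assoc[symmetric] \<sigma>2 using abs_moebius_less_one[OF x] by simp
  ultimately have "pser (diffs ?c) ?y \<noteq> 0"
    using nz pser_diffs_signed[OF c, of \<sigma> "\<sigma> * ?y"]
    by (simp add: mult.assoc[symmetric] \<sigma>2)
  moreover have "poly (pderiv ([:1, 1:] * ?p)) x = pser (diffs ?c) ?y / (1 + x) ^ 2"
    by (rule poly_pderiv_eq_pser_moebius[OF c x])
       (simp only: p_poly_series[OF _ n, symmetric] poly_mult, simp)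
  moreover have "poly (pderiv ([:1, 1:] * ?p)) x = (1 + x) * poly (pderiv ?p) x"
    unfolding pderiv_mult using zero by (simp add: pderiv_pCons algebra_simps)
  ultimately have "poly (pderiv ?p) x \<noteq> 0" using x by auto
  thus ?thesis using order_eq_1[OF zero] by auto
qed

text \<open>With x = \<sigma> u, the variable \<sigma> x/(1+x) of the reflected series equals u/(1 +
  \<sigma> u); \<open>u\<close> inverts this map.\<close>

lemma moebius_inverse:
  fixes \<sigma> \<zeta> :: real
  assumes "\<bar>\<sigma>\<bar> = 1" "0 < \<zeta>" "\<zeta> < 1"
  defines "u \<equiv> \<zeta> / (1 - \<sigma> * \<zeta>)"
  shows "0 < u" "- 1 / 2 < \<sigma> * u" "u / (1 + \<sigma> * u) = \<zeta>"
proof -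
  have \<sigma>: "\<sigma> = 1 \<or> \<sigma> = -1" using assms(1) by (auto simp: abs_if split: if_splits)
  have d: "0 < 1 - \<sigma> * \<zeta>" using \<sigma> assms by auto
  show "0 < u" using d assms by (simp add: u_def)
  show "- 1 / 2 < \<sigma> * u" using \<sigma> assms by (auto simp: u_def field_simps)
  have "1 + \<sigma> * u = 1 / (1 - \<sigma> * \<zeta>)" using d by (simp add: u_def field_simps)
  thus "u / (1 + \<sigma> * u) = \<zeta>" using d by (simp add: u_def)
qed

text \<open>The zeros from \<open>zeros_localized\<close> with N = n - K are pulled back by \<zeta>
  -> \<zeta>/(1 - \<sigma> \<zeta>), which is increasing on (0,1) for both signs.\<close>

lemma p_poly_zeros_localized:
  fixes \<gamma> K
  defines "c \<equiv> signed_coeff (P_poly \<gamma> K)"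
  assumes \<sigma>: "\<bar>\<sigma>\<bar> = 1" and T: "finite T" "T \<subseteq> sign_changes (c \<sigma>)" and \<epsilon>: "0 < \<epsilon>" "\<epsilon> < 1"
    and R: "sign_isolating (c \<sigma>) T R"
  shows "eventually (\<lambda>n. \<exists>\<xi>. strict_mono_on T \<xi> \<and>
           (\<forall>l\<in>T. \<bar>\<xi> l / (1 + \<sigma> * \<xi> l) / zero_scale (c \<sigma>) l (n - K) - 1\<bar> < \<epsilon>) \<and>
           {u. 0 < u \<and> - 1 / 2 < \<sigma> * u \<and> u / (1 + \<sigma> * u) < R (n - K) \<and>
               poly (p_poly \<gamma> K n) (\<sigma> * u) = 0} = \<xi> ` T \<and>
           (\<forall>l\<in>T. p_poly \<gamma> K n \<noteq> 0 \<and> order (\<sigma> * \<xi> l) (p_poly \<gamma> K n) = 1)) sequentially"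
proof -
  have \<sigma>1: "\<sigma> = 1 \<or> \<sigma> = -1" using \<sigma> by (auto simp: abs_if split: if_splits)
  hence \<sigma>2: "\<sigma> * \<sigma> = 1" by auto
  have "eventually (\<lambda>N. R N \<le> 1 \<and> (\<exists>\<zeta>. strict_mono_on T \<zeta> \<and>
           (\<forall>l\<in>T. \<bar>\<zeta> l / zero_scale (c \<sigma>) l N - 1\<bar> < \<epsilon>) \<and>
           {z. 0 < z \<and> z < R N \<and> pser (\<lambda>k. c \<sigma> k * real k ^ N) z = 0} = \<zeta> ` T \<and>
           (\<forall>l\<in>T. pser (diffs (\<lambda>k. c \<sigma> k * real k ^ N)) (\<zeta> l) \<noteq> 0))) sequentially"
    using R[unfolded sign_isolating_def] zeros_localized[OF _ T \<epsilon> R] disc_summable_signed_coeff[OF \<sigma>]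
    unfolding c_def by (auto elim: eventually_elim2)
  from eventually_compose_filterlim[OF this filterlim_minus_const_nat_at_top[of K]]
  show ?thesis using eventually_ge_at_top[of K]
  proof eventually_elim
    case (elim n)
    let ?F = "pser (\<lambda>k. c \<sigma> k * real k ^ (n - K))" and ?R = "R (n - K)" and ?p = "p_poly \<gamma> K n"
    from elim obtain \<zeta> where R1: "?R \<le> 1" and mono: "strict_mono_on T \<zeta>"
      and near: "\<And>l. l \<in> T \<Longrightarrow> \<bar>\<zeta> l / zero_scale (c \<sigma>) l (n - K) - 1\<bar> < \<epsilon>"
      and zeros: "{z. 0 < z \<and> z < ?R \<and> ?F z = 0} = \<zeta> ` T"
      and simple: "\<And>l. l \<in> T \<Longrightarrow> pser (diffs (\<lambda>k. c \<sigma> k * real k ^ (n - K))) (\<zeta> l) \<noteq> 0"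
      by blast
    have \<zeta>: "0 < \<zeta> l" "\<zeta> l < ?R" "\<zeta> l < 1" "?F (\<zeta> l) = 0" if "l \<in> T" for l
    proof -
      have "\<zeta> l \<in> {z. 0 < z \<and> z < ?R \<and> ?F z = 0}" using zeros that by simp
      thus "0 < \<zeta> l" "\<zeta> l < ?R" "\<zeta> l < 1" "?F (\<zeta> l) = 0" using R1 by auto
    qed
    define \<xi> where "\<xi> l = \<zeta> l / (1 - \<sigma> * \<zeta> l)" for l
    have \<xi>: "0 < \<xi> l" "- 1 / 2 < \<sigma> * \<xi> l" "\<xi> l / (1 + \<sigma> * \<xi> l) = \<zeta> l" if "l \<in> T" for l
      using moebius_inverse[OF \<sigma>, of "\<zeta> l"] \<zeta>[OF that] by (auto simp: \<xi>_def)
    have y: "\<sigma> * (\<sigma> * u / (1 + \<sigma> * u)) = u / (1 + \<sigma> * u)" for u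
      using \<sigma>2 by (simp add: mult.assoc[symmetric])
    have zero_iff: "poly ?p (\<sigma> * u) = 0 \<longleftrightarrow> ?F (u / (1 + \<sigma> * u)) = 0" if "- 1 / 2 < \<sigma> * u" for u
      using p_poly_zero_iff[OF that elim(2) \<sigma>] by (simp only: y c_def)
    have "strict_mono_on T \<xi>"
    proof (rule strict_mono_onI)
      fix l l' assume l: "l \<in> T" "l' \<in> T" "l < l'"
      hence "\<zeta> l < \<zeta> l'" using strict_mono_onD[OF mono] by blast
      moreover have "0 < 1 - \<sigma> * \<zeta> l" "0 < 1 - \<sigma> * \<zeta> l'" using \<sigma>1 \<zeta>[OF l(1)] \<zeta>[OF l(2)] by auto
      ultimately show "\<xi> l < \<xi> l'"
        by (simp add: \<xi>_def pos_divide_less_eq pos_less_divide_eq field_simps)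
    qed
    moreover have "\<forall>l\<in>T. \<bar>\<xi> l / (1 + \<sigma> * \<xi> l) / zero_scale (c \<sigma>) l (n - K) - 1\<bar> < \<epsilon>"
      using near \<xi>(3) by auto
    moreover have "{u. 0 < u \<and> - 1 / 2 < \<sigma> * u \<and> u / (1 + \<sigma> * u) < ?R \<and> poly ?p (\<sigma> * u) = 0} = \<xi> ` T"
      (is "?U = _")
    proof
      show "?U \<subseteq> \<xi> ` T"
      proof
        fix u assume u: "u \<in> ?U"
        hence pos: "0 < 1 + \<sigma> * u" by auto
        have "u / (1 + \<sigma> * u) \<in> {z. 0 < z \<and> z < ?R \<and> ?F z = 0}"
          using u pos zero_iff[of u] by auto
        then obtain l where l: "l \<in> T" "u / (1 + \<sigma> * u) = \<zeta> l" unfolding zeros by auto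
        have "1 - \<sigma> * \<zeta> l = 1 / (1 + \<sigma> * u)" using pos by (simp add: l(2)[symmetric] field_simps)
        hence "\<xi> l = u" using pos by (simp add: \<xi>_def l(2)[symmetric])
        thus "u \<in> \<xi> ` T" using l by auto
      qed
      show "\<xi> ` T \<subseteq> ?U"
        using \<xi> \<zeta> zero_iff by auto
    qed
    moreover have "\<forall>l\<in>T. ?p \<noteq> 0 \<and> order (\<sigma> * \<xi> l) ?p = 1"
    proof
      fix l assume l: "l \<in> T"
      show "?p \<noteq> 0 \<and> order (\<sigma> * \<xi> l) ?p = 1"
      proof (rule p_poly_simple_zero[OF \<xi>(2)[OF l] elim(2) \<sigma>])
        show "poly ?p (\<sigma> * \<xi> l) = 0" using zero_iff[OF \<xi>(2)[OF l]] \<xi>(3)[OF l] \<zeta>(4)[OF l] by simp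
        show "pser (diffs (\<lambda>k. signed_coeff (P_poly \<gamma> K) \<sigma> k * real k ^ (n - K)))
            (\<sigma> * (\<sigma> * \<xi> l / (1 + \<sigma> * \<xi> l))) \<noteq> 0"
          using simple[OF l] unfolding y \<xi>(3)[OF l] by (simp add: c_def)
      qed
    qed
    ultimately show ?case by blast
  qed
qed

subsection \<open>Enumeration and asymptotics of the zeros\<close>

lemma abs_zeros_localized:
  fixes \<gamma> K
  defines "c \<equiv> signed_coeff (P_poly \<gamma> K)"
  assumes \<sigma>: "\<bar>\<sigma>\<bar> = 1" and s: "strict_mono_on {..<m} s" "s ` {..<m} \<subseteq> sign_changes (c \<sigma>)"
    and \<epsilon>: "0 < \<epsilon>" "\<epsilon> < 1" and R: "sign_isolating (c \<sigma>) (s ` {..<m}) R"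
  shows "eventually (\<lambda>n. m \<le> length (abs_zeros \<sigma> (p_poly \<gamma> K n)) \<and>
           (\<forall>i<m. let u = abs_zeros \<sigma> (p_poly \<gamma> K n) ! i in
              \<bar>u / (1 + \<sigma> * u) / zero_scale (c \<sigma>) (s i) (n - K) - 1\<bar> < \<epsilon> \<and>
              order (\<sigma> * u) (p_poly \<gamma> K n) = 1)) sequentially"
proof -
  have \<sigma>1: "\<sigma> = 1 \<or> \<sigma> = -1" using \<sigma> by (auto simp: abs_if split: if_splits)
  hence \<sigma>2: "\<sigma> * \<sigma> = 1" by auto
  show ?thesis
    using p_poly_zeros_localized[OF \<sigma> finite_imageI[OF finite_lessThan] s(2)[unfolded c_def] \<epsilon> R[unfolded c_def]]
    unfolding c_def[symmetric]
  proof eventually_elim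
    case (elim n)
    let ?p = "p_poly \<gamma> K n" and ?T = "s ` {..<m}"
    obtain \<xi> where mono: "strict_mono_on ?T \<xi>"
      and near: "\<forall>l\<in>?T. \<bar>\<xi> l / (1 + \<sigma> * \<xi> l) / zero_scale (c \<sigma>) l (n - K) - 1\<bar> < \<epsilon>"
      and zeros: "{u. 0 < u \<and> - 1 / 2 < \<sigma> * u \<and> u / (1 + \<sigma> * u) < R (n - K) \<and>
               poly ?p (\<sigma> * u) = 0} = \<xi> ` ?T" (is "?U = _")
      and simple: "\<forall>l\<in>?T. ?p \<noteq> 0 \<and> order (\<sigma> * \<xi> l) ?p = 1"
      using elim by (elim exE conjE) (rule that)
    note near = bspec[OF near] and simple = bspec[OF simple]
    define f where "f i = \<xi> (s i)" for i
    define M where "M = image_mset ((*) \<sigma>) (filter_mset (\<lambda>x. 0 < \<sigma> * x) (proots ?p))"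
    have f: "0 < f i" "- 1 / 2 < \<sigma> * f i" "f i / (1 + \<sigma> * f i) < R (n - K)" if "i < m" for i
    proof -
      have "f i \<in> ?U" unfolding zeros using that by (auto simp: f_def)
      thus "0 < f i" "- 1 / 2 < \<sigma> * f i" "f i / (1 + \<sigma> * f i) < R (n - K)" by auto
    qed
    have "m \<le> length (sorted_list_of_multiset M) \<and> (\<forall>i<m. sorted_list_of_multiset M ! i = f i)"
    proof (rule sorted_list_of_multiset_initial)
      show "strict_mono_on {..<m} f"
        unfolding f_def using s(1) mono by (auto intro!: strict_mono_onI dest: strict_mono_onD)
    next
      fix i assume i: "i < m"
      have p: "?p \<noteq> 0" "order (\<sigma> * f i) ?p = 1" using simple[of "s i"] i by (auto simp: f_def)
      \<comment> \<open>Multiplication by \<sigma> is injective, so reflecting the multiset of roots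
        keeps multiplicities.\<close>
      have inv: "(*) \<sigma> -` {f i} = {\<sigma> * f i}"
        using \<sigma>1 by auto
      have "poly ?p (\<sigma> * f i) = 0" using p by (metis order_root one_neq_zero)
      thus "count M (f i) = 1"
        using p f[OF i] \<sigma>2 unfolding M_def count_image_mset inv
        by (simp add: mult.assoc[symmetric])
    next
      fix x i assume x: "x \<in># M" "i < m" "x \<le> f i"
      have p: "?p \<noteq> 0" using simple[of "s i"] x by auto
      have x0: "0 < x" "poly ?p (\<sigma> * x) = 0"
        using x(1) p \<sigma>2 by (auto simp: M_def mult.assoc[symmetric])
      have x1: "- 1 / 2 < \<sigma> * x" using \<sigma>1 x(3) x0 f(2)[OF x(2)] by auto
      \<comment> \<open>The map u -> u/(1 + \<sigma> u) is increasing, so a zero of smaller modulus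
        than a listed one also lies below R and is therefore listed.\<close>
      have "x * (1 + \<sigma> * f i) \<le> f i * (1 + \<sigma> * x)" using x(3) by (simp add: algebra_simps)
      hence "x / (1 + \<sigma> * x) \<le> f i / (1 + \<sigma> * f i)"
        using x1 f(2)[OF x(2)] by (simp add: divide_simps)
      hence "x \<in> ?U" using x0 x1 f(3)[OF x(2)] by simp
      thus "x \<in> f ` {..<m}" unfolding zeros by (auto simp: f_def)
    qed
    thus ?case
      using near simple by (auto simp: abs_zeros_def M_def f_def Let_def)
  qed
qed

text \<open>For z = u/(1 + \<sigma> u) localization gives z/t -> 1, and t -> 0 then gives z -> 0. As
  u = z/(1 - \<sigma> z), the passage from z back to u costs a factor tending to 1.\<close>

lemma abs_zeros_asymptotic:
  fixes \<gamma> K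
  defines "c \<equiv> signed_coeff (P_poly \<gamma> K)"
  assumes \<sigma>: "\<bar>\<sigma>\<bar> = 1" and s: "strict_mono_on {..<m} s" "s ` {..<m} \<subseteq> sign_changes (c \<sigma>)"
    and R: "sign_isolating (c \<sigma>) (s ` {..<m}) R" and i: "i < m"
  shows "(\<lambda>n. abs_zeros \<sigma> (p_poly \<gamma> K n) ! i / zero_scale (c \<sigma>) (s i) (n - K)) \<longlonglongrightarrow> 1"
proof -
  define u t z where "u n = abs_zeros \<sigma> (p_poly \<gamma> K n) ! i"
    and "t n = zero_scale (c \<sigma>) (s i) (n - K)" and "z n = u n / (1 + \<sigma> * u n)" for n
  have t: "0 < t n" for n
    unfolding t_def using s(2) i by (intro zero_scale_pos) auto
  have t0: "t \<longlonglongrightarrow> 0"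
    unfolding t_def
    by (rule filterlim_compose[OF zero_scale_tendsto_0 filterlim_minus_const_nat_at_top])
  have near: "eventually (\<lambda>n. \<bar>z n / t n - 1\<bar> < \<epsilon>) sequentially" if "0 < \<epsilon>" "\<epsilon> < 1" for \<epsilon>
    using abs_zeros_localized[OF \<sigma> s[unfolded c_def] that R[unfolded c_def]] unfolding c_def[symmetric]
    by eventually_elim (use i in \<open>auto simp: Let_def u_def t_def z_def\<close>)
  have zt: "(\<lambda>n. z n / t n) \<longlonglongrightarrow> 1"
  proof (rule tendstoI)
    fix e :: real assume "0 < e"
    hence "eventually (\<lambda>n. \<bar>z n / t n - 1\<bar> < min e (1 / 2)) sequentially" by (intro near) auto
    thus "eventually (\<lambda>n. dist (z n / t n) 1 < e) sequentially"
      by eventually_elim (simp add: dist_real_def)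
  qed
  have "(\<lambda>n. z n / t n * t n) \<longlonglongrightarrow> 1 * 0" by (intro tendsto_mult zt t0)
  moreover have "z n / t n * t n = z n" for n using t[of n] by simp
  ultimately have z0: "z \<longlonglongrightarrow> 0" by simp
  have "(\<lambda>n. z n / t n / (1 - \<sigma> * z n)) \<longlonglongrightarrow> 1 / (1 - \<sigma> * 0)"
    by (intro tendsto_intros zt z0) simp
  moreover have "eventually (\<lambda>n. z n / t n / (1 - \<sigma> * z n) = u n / t n) sequentially"
    using near[of "1 / 2", simplified]
  proof eventually_elim
    case (elim n)
    \<comment> \<open>A vanishing denominator would give \<open>z n = 0\<close> by the convention
      for division by 0, against \<open>z n / t n\<close> being within 1/2 of 1.\<close>
    have "1 + \<sigma> * u n \<noteq> 0" using elim by (auto simp: z_def)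
    moreover from this have "1 - \<sigma> * z n = 1 / (1 + \<sigma> * u n)" by (simp add: z_def field_simps)
    ultimately show ?case by (simp add: z_def)
  qed
  ultimately have "(\<lambda>n. u n / t n) \<longlonglongrightarrow> 1" by (simp add: tendsto_cong)
  thus ?thesis by (simp add: u_def t_def)
qed

text \<open>Each sign change l traps a root of P between l and l + 1, and the roots of a nonzero
  polynomial are bounded.\<close>

lemma finite_H_set:
  assumes "poly P 1 \<noteq> 0"
  shows "finite (H_set P)"
proof -
  have "P \<noteq> 0" using assms by auto
  hence "finite {x. poly P x = 0}" by (rule poly_roots_finite)
  then obtain B where B: "\<And>x. poly P x = 0 \<Longrightarrow> x \<le> B"
    using bdd_above_finite[of "{x. poly P x = 0}"] by (auto simp: bdd_above_def)
  have "real l \<le> B" if "l \<in> H_set P" for l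
  proof -
    have "\<exists>x>real l. x < real (l + 1) \<and> poly P x = 0"
      using that by (intro poly_IVT) (auto simp: H_set_def)
    thus ?thesis using B by force
  qed
  hence "H_set P \<subseteq> {..nat \<lfloor>B\<rfloor>}" by (auto simp: le_nat_floor)
  thus ?thesis by (rule finite_subset) simp
qed

lemma H_set_eq_sign_changes: "H_set P = sign_changes (signed_coeff P 1)"
  by (simp add: H_set_def sign_changes_def signed_coeff_def add.commute)

text \<open>The alternating factor negates every product of neighbours. As P has no positive integer
  zero, a product that is not negative is positive, so the sign changes become the complement of
  H.\<close>

lemma G_set_eq_sign_changes:
  assumes "\<And>k. 0 < k \<Longrightarrow> poly P (real k) \<noteq> 0"
  shows "G_set P = sign_changes (signed_coeff P (-1))"
proof -
  have prod: "signed_coeff P (-1) l * signed_coeff P (-1) (Suc l) = - (poly P (real l) * poly P (real (l + 1)))" for l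
  proof -
    have "(- 1 :: real) ^ l * (- 1) ^ Suc l = - 1" by (simp flip: power_mult_distrib)
    thus ?thesis by (simp add: signed_coeff_def algebra_simps flip: power_mult_distrib)
  qed
  have sgn: "\<not> poly P (real l) * poly P (real (l + 1)) < 0 \<longleftrightarrow>
      - (poly P (real l) * poly P (real (l + 1))) < 0" if "0 < l" for l
    using assms[of l] assms[of "l + 1"] that mult_eq_0_iff[of "poly P (real l)" "poly P (real (l + 1))"]
    by linarith
  show ?thesis
  proof (rule set_eqI)
    fix l
    show "l \<in> G_set P \<longleftrightarrow> l \<in> sign_changes (signed_coeff P (-1))"
      using sgn[of l] unfolding G_set_def H_set_def sign_changes_def mem_Collect_eq Diff_iff prod
      by metis
  qed
qed

lemma strict_mono_on_enumerate: "infinite S \<Longrightarrow> strict_mono_on {..<m} (enumerate S)"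
  for S :: "nat set"
  by (simp add: strict_mono_onI enumerate_mono)

text \<open>Identifies the first m elements with the set of sign changes up to some g, the form
  needed by \<open>sign_isolating_initial\<close>.\<close>

lemma enumerate_initial_segment:
  fixes S :: "nat set"
  assumes "infinite S" "0 < m"
  shows "enumerate S ` {..<m} = {l \<in> S. l \<le> enumerate S (m - 1)}"
proof
  show "enumerate S ` {..<m} \<subseteq> {l \<in> S. l \<le> enumerate S (m - 1)}"
    using assms by (auto simp: enumerate_in_set)
  show "{l \<in> S. l \<le> enumerate S (m - 1)} \<subseteq> enumerate S ` {..<m}"
  proof
    fix l assume l: "l \<in> {l \<in> S. l \<le> enumerate S (m - 1)}"
    then obtain i where i: "enumerate S i = l" using enumerate_Ex[OF assms(1)] by blast
    with l assms have "i < m" by auto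
    with i show "l \<in> enumerate S ` {..<m}" by blast
  qed
qed

theorem theorem4p2:
  fixes K :: nat and \<gamma> :: "nat \<Rightarrow> real"
    and p :: "nat \<Rightarrow> real poly" and P :: "real poly" and H G :: "nat set"
  assumes gamma0: "\<gamma> 0 = 1"
    and p: "p = p_poly \<gamma> K"
    and P: "P = P_poly \<gamma> K"
    and P_nonzero: "\<forall>m::nat. 0 < m \<longrightarrow> poly P (real m) \<noteq> 0"
    and H: "H = H_set P"
    and G: "G = G_set P"
  shows "finite H \<and> infinite G \<and>
    (\<exists>n0. \<forall>n\<ge>n0. card {x. 0 < x \<and> poly (p n) x = 0} = card H \<and>
       (\<forall>x>0. poly (p n) x = 0 \<longrightarrow> order x (p n) = 1)) \<and>
    (\<forall>m. 1 \<le> m \<and> m \<le> card H \<longrightarrow>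
       (let h = nth_elem H m in
         (\<lambda>n. xi_pos (p n) m /
            (- (poly P (real h) / poly P (real (h + 1)))
               * (real h / real (h + 1)) powi (int n - int K))) \<longlonglongrightarrow> 1)) \<and>
    (\<forall>m\<ge>1. (\<exists>n0. \<forall>n\<ge>n0. m \<le> length (neg_zeros (p n))) \<and>
       (let g = nth_elem G m in
         (\<lambda>n. xi_neg (p n) m /
            (- (poly P (real g) / poly P (real (g + 1)))
               * (real g / real (g + 1)) powi (int n - int K))) \<longlonglongrightarrow> 1)) \<and>
    (\<forall>m\<ge>1. \<exists>n0. \<forall>n\<ge>n0. card {x. 0 < x \<and> poly (p n) x = 0} = card H \<and>
       (\<forall>x>0. poly (p n) x = 0 \<longrightarrow> order x (p n) = 1) \<and>
       m \<le> length (neg_zeros (p n)) \<and>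
       (\<forall>i. 1 \<le> i \<and> i \<le> m \<longrightarrow> order (xi_neg (p n) i) (p n) = 1))"
proof -
  have P_nz: "poly P (real k) \<noteq> 0" if "0 < k" for k using P_nonzero that by blast
  define c where "c = signed_coeff P"
  have c_eq: "c = signed_coeff (P_poly \<gamma> K)" by (simp add: c_def P)
  have c_nz: "c \<sigma> k \<noteq> 0" if "\<bar>\<sigma>\<bar> = 1" "0 < k" for \<sigma> k
    using P_nz[OF that(2)] that(1) by (auto simp: c_def signed_coeff_def)
  have c_sum: "disc_summable (c \<sigma>)" if "\<bar>\<sigma>\<bar> = 1" for \<sigma>
    unfolding c_def by (rule disc_summable_signed_coeff[OF that])
  have HS: "H = sign_changes (c 1)" unfolding H c_def by (rule H_set_eq_sign_changes)
  have GS: "G = sign_changes (c (-1))"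
    unfolding G c_def by (rule G_set_eq_sign_changes[OF P_nz])
  have finH: "finite H" unfolding H using P_nz[of 1] by (intro finite_H_set) simp
  have infG: "infinite G"
  proof -
    have "infinite ({0<..} :: nat set)" by (rule infinite_Ioi)
    thus ?thesis unfolding G G_set_def H[symmetric]
      using finH by (metis Diff_infinite_finite greaterThan_def)
  qed
  have R_pos: "sign_isolating (c 1) H (\<lambda>_. 1)"
    unfolding HS by (rule sign_isolating_all) (use c_sum c_nz finH HS in auto)
  have H_subset: "H \<subseteq> sign_changes (c 1)" using HS by simp
  have half_less_one: "(1 / 2 :: real) < 1" by simp
  have pos: "eventually (\<lambda>n. card {x. 0 < x \<and> poly (p n) x = 0} = card H \<and>
      (\<forall>x>0. poly (p n) x = 0 \<longrightarrow> order x (p n) = 1)) sequentially"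
    using p_poly_zeros_localized[of 1 H \<gamma> K "1 / 2" "\<lambda>_. 1", folded c_eq,
        OF abs_one finH H_subset half_gt_zero[OF zero_less_one] half_less_one R_pos]
  proof eventually_elim
    case (elim n)
    obtain \<xi> where \<xi>: "strict_mono_on H \<xi>"
      "{u. 0 < u \<and> - 1 / 2 < 1 * u \<and> u / (1 + 1 * u) < 1 \<and> poly (p_poly \<gamma> K n) (1 * u) = 0} = \<xi> ` H"
      "\<forall>l\<in>H. p_poly \<gamma> K n \<noteq> 0 \<and> order (1 * \<xi> l) (p_poly \<gamma> K n) = 1"
      using elim by (elim exE conjE) (rule that)
    \<comment> \<open>For \<sigma> = 1 and R = 1 the conditions -1/2 < u and u/(1+u) < 1 hold for
      every u > 0, so all positive zeros are captured.\<close>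
    have Z: "{x. 0 < x \<and> poly (p n) x = 0} = \<xi> ` H"
      unfolding \<xi>(2)[symmetric] p by auto
    have "order x (p n) = 1" if "0 < x" "poly (p n) x = 0" for x
    proof -
      have "x \<in> \<xi> ` H" using that Z by blast
      thus ?thesis using \<xi>(3) by (auto simp: p)
    qed
    moreover have "card {x. 0 < x \<and> poly (p n) x = 0} = card H"
      unfolding Z by (rule card_image[OF strict_mono_on_imp_inj_on[OF \<xi>(1)]])
    ultimately show ?case by blast
  qed
  have enumH: "strict_mono_on {..<card H} (enumerate H)" "enumerate H ` {..<card H} = H"
    using finite_enumerate_mono[OF _ finH] bij_betw_imp_surj_on[OF finite_bij_enumerate[OF finH]]
    by (auto intro!: strict_mono_onI)
  have pos_lim: "(\<lambda>n. xi_pos (p n) m /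
            (- (poly P (real (nth_elem H m)) / poly P (real (nth_elem H m + 1)))
               * (real (nth_elem H m) / real (nth_elem H m + 1)) powi (int n - int K))) \<longlonglongrightarrow> 1"
    if m: "1 \<le> m" "m \<le> card H" for m
  proof -
    have "(\<lambda>n. abs_zeros 1 (p n) ! (m - 1) / zero_scale (c 1) (nth_elem H m) (n - K)) \<longlonglongrightarrow> 1"
      unfolding nth_elem_def p
      by (rule abs_zeros_asymptotic[where \<gamma> = \<gamma> and K = K and m = "card H" and R = "\<lambda>_. 1", folded c_eq],
          unfold enumH(2)) (use enumH(1) H_subset R_pos m in auto)
    moreover have "eventually (\<lambda>n. abs_zeros 1 (p n) ! (m - 1) / zero_scale (c 1) (nth_elem H m) (n - K) =
        xi_pos (p n) m / (- (poly P (real (nth_elem H m)) / poly P (real (nth_elem H m + 1)))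
          * (real (nth_elem H m) / real (nth_elem H m + 1)) powi (int n - int K))) sequentially"
      using eventually_ge_at_top[of K]
    proof eventually_elim
      case (elim n)
      \<comment> \<open>For n >= K the truncated difference agrees with the integer exponent of the
        statement.\<close>
      hence "int n - int K = int (n - K)" by simp
      thus ?case
        by (simp add: xi_pos_def pos_zeros_eq zero_scale_def c_def signed_coeff_def add.commute
              del: of_nat_diff)
    qed
    ultimately show ?thesis by (rule Lim_transform_eventually)
  qed
  have enumG: "strict_mono_on {..<m} (enumerate G)" "enumerate G ` {..<m} \<subseteq> sign_changes (c (-1))" for m
    using strict_mono_on_enumerate[OF infG] enumerate_in_set[OF infG] GS by auto
  have R_neg: "sign_isolating (c (-1)) (enumerate G ` {..<m})
      (\<lambda>N. 2 * zero_scale (c (-1)) (enumerate G (m - 1)) N)" if "1 \<le> m" for m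
  proof -
    have "enumerate G ` {..<m} = {l \<in> sign_changes (c (-1)). l \<le> enumerate G (m - 1)}"
      using enumerate_initial_segment[OF infG, of m] that unfolding GS by simp
    moreover have "enumerate G (m - 1) \<in> sign_changes (c (-1))"
      using enumerate_in_set[OF infG] GS by simp
    ultimately show ?thesis
      using sign_isolating_initial[of "c (-1)" "enumerate G (m - 1)"] c_sum[of "-1"] c_nz[of "-1"]
      by simp
  qed
  have neg: "eventually (\<lambda>n. m \<le> length (neg_zeros (p n)) \<and>
      (\<forall>i. 1 \<le> i \<and> i \<le> m \<longrightarrow> order (xi_neg (p n) i) (p n) = 1)) sequentially" if m: "1 \<le> m" for m
    using abs_zeros_localized[of "-1" m "enumerate G" \<gamma> K "1 / 2", folded c_eq,
        OF abs_neg_one enumG half_gt_zero[OF zero_less_one] half_less_one R_neg[OF m]]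
    unfolding p[symmetric] fun_cong[OF p, symmetric]
  proof eventually_elim
    case (elim n)
    let ?L = "abs_zeros (-1) (p n)"
    have L: "m \<le> length ?L" "\<And>i. i < m \<Longrightarrow> order (- (?L ! i)) (p n) = 1"
      using elim by (simp_all add: Let_def)
    show ?case
    proof (intro conjI allI impI)
      show "m \<le> length (neg_zeros (p n))" using L(1) by (simp add: neg_zeros_eq)
      fix i assume "1 \<le> i \<and> i \<le> m"
      hence "i - 1 < m" by auto
      thus "order (xi_neg (p n) i) (p n) = 1"
        using L by (simp add: xi_neg_def neg_zeros_eq)
    qed
  qed
  have neg_lim: "(\<lambda>n. xi_neg (p n) m /
            (- (poly P (real (nth_elem G m)) / poly P (real (nth_elem G m + 1)))
               * (real (nth_elem G m) / real (nth_elem G m + 1)) powi (int n - int K))) \<longlonglongrightarrow> 1"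
    if m: "1 \<le> m" for m
  proof -
    have "(\<lambda>n. abs_zeros (-1) (p n) ! (m - 1) / zero_scale (c (-1)) (nth_elem G m) (n - K)) \<longlonglongrightarrow> 1"
      unfolding nth_elem_def p
      by (rule abs_zeros_asymptotic[where \<gamma> = \<gamma> and K = K, folded c_eq, OF _ enumG R_neg[OF m]]) (use m in auto)
    \<comment> \<open>Two minus signs cancel: \<open>xi_neg\<close> is minus the modulus, and for
      \<sigma> = -1 the ratio of neighbouring coefficients is minus the ratio of the values of
      P.\<close>
    moreover have "eventually (\<lambda>n. abs_zeros (-1) (p n) ! (m - 1) / zero_scale (c (-1)) (nth_elem G m) (n - K) =
        xi_neg (p n) m / (- (poly P (real (nth_elem G m)) / poly P (real (nth_elem G m + 1)))
          * (real (nth_elem G m) / real (nth_elem G m + 1)) powi (int n - int K))) sequentially"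
      using eventually_ge_at_top[of K] neg[OF m]
    proof eventually_elim
      case (elim n)
      hence "int n - int K = int (n - K)" by simp
      moreover have "m - 1 < length (abs_zeros (-1) (p n))"
        using conjunct1[OF elim(2)] m by (simp add: neg_zeros_eq)
      ultimately show ?case
        by (simp add: xi_neg_def neg_zeros_eq zero_scale_def c_def signed_coeff_def add.commute
              del: of_nat_diff)
    qed
    ultimately show ?thesis by (rule Lim_transform_eventually)
  qed
  show ?thesis
    unfolding Let_def
  proof (intro conjI allI impI)
    show "finite H" "infinite G" by fact+
    show "\<exists>n0. \<forall>n\<ge>n0. card {x. 0 < x \<and> poly (p n) x = 0} = card H \<and>
        (\<forall>x>0. poly (p n) x = 0 \<longrightarrow> order x (p n) = 1)"
      using pos by (simp add: eventually_sequentially)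
  next
    fix m assume "1 \<le> m \<and> m \<le> card H"
    thus "(\<lambda>n. xi_pos (p n) m /
            (- (poly P (real (nth_elem H m)) / poly P (real (nth_elem H m + 1)))
               * (real (nth_elem H m) / real (nth_elem H m + 1)) powi (int n - int K))) \<longlonglongrightarrow> 1"
      using pos_lim by blast
  next
    fix m :: nat assume m: "1 \<le> m"
    show "\<exists>n0. \<forall>n\<ge>n0. m \<le> length (neg_zeros (p n))"
      using eventually_mono[OF neg[OF m] conjunct1] unfolding eventually_sequentially .
    show "(\<lambda>n. xi_neg (p n) m /
            (- (poly P (real (nth_elem G m)) / poly P (real (nth_elem G m + 1)))
               * (real (nth_elem G m) / real (nth_elem G m + 1)) powi (int n - int K))) \<longlonglongrightarrow> 1"
      by (rule neg_lim[OF m])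
    show "\<exists>n0. \<forall>n\<ge>n0. card {x. 0 < x \<and> poly (p n) x = 0} = card H \<and>
       (\<forall>x>0. poly (p n) x = 0 \<longrightarrow> order x (p n) = 1) \<and>
       m \<le> length (neg_zeros (p n)) \<and>
       (\<forall>i. 1 \<le> i \<and> i \<le> m \<longrightarrow> order (xi_neg (p n) i) (p n) = 1)"
      using eventually_conj[OF pos neg[OF m]] unfolding eventually_sequentially conj_assoc .
  qed
qed

end
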